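(* Let $\alpha\ge0$ be real and $r_\alpha(n)=\sqrt[n]{\overline{p}(n)/n^{\alpha}}$. For all integers $n\ge N_T(\alpha)$, $$4\bigl(r_\alpha(n)^2-r_\alpha(n-1)r_\alpha(n+1)\bigr)\bigl(r_\alpha(n+1)^2-r_\alpha(n)r_\alpha(n+2)\bigr)-\bigl(r_\alpha(n)r_\alpha(n+1)-r_\alpha(n-1)r_\alpha(n+2)\bigr)^2<0.$$
   Context: $\overline{p}(n)$ is the number of overpartitions of $n$ (partitions of $n$ into non-increasing parts in which the first occurrence of each part size may be overlined). Define $\widetilde N_1(\alpha)=\max\{\lceil\sqrt{2\alpha}\rceil,\lceil\sqrt[3]{3\alpha}\rceil,\lceil\sqrt[4]{11\alpha/3}\rceil,\lceil\sqrt[5]{10\alpha}\rceil\}$, $\widetilde N_2(\alpha)=\max\{2,\lceil\sqrt{2\alpha}\rceil,\lceil\sqrt[3]{3\alpha}\rceil,\lceil\sqrt[4]{11\alpha/3}\rceil,\lceil\sqrt[5]{12\alpha}\rceil\}$, $\widetilde N_3(\alpha)=\max\{5505,\lceil(4\alpha/(\alpha^2+1))^{4/3}\rceil,\lceil(4\alpha)^{4/11}\rceil\}$, $\widetilde N(\alpha)=\max_{1\le i\le3}\widetilde N_i(\alpha)$. $n_u(\alpha)=\max\{\lceil e^{(6\alpha+2^{12}+2^{31+18\alpha})/(2+17\alpha)}\rceil,\lceil(4+34\alpha)^{19}\rceil\}$; $n_l(\alpha)=\max\{\lceil e^{258/(80+2^{16+7\alpha})}\rceil,\lceil(160+2^{17+7\alpha})^{19}\rceil\}$;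 $n_{u_1}(\alpha)=\max\{\lceil e^{(12+4122\pi^2-12\pi^2\log 8+32\alpha\pi^2+2^{31+18\alpha}\pi^2)/(\pi^2(2+17\alpha))}\rceil,\lceil\pi^{38}(4+34\alpha)^{19}\rceil\}$; $n_{l_1}(\alpha)=\max\{\lceil e^{(256+\frac{105(9\pi^2(4+\pi^2)-16)}{128\pi^3})/(8(3\alpha+2^{13+7\alpha}+13))}\rceil,\lceil16^{19}(3\alpha+2^{13+7\alpha}+13)^{19}\rceil\}$; $N_1(\alpha)=\max\{n_u(\alpha),n_l(\alpha),n_{u_1}(\alpha),n_{l_1}(\alpha)\}$. $N_2(\alpha)=\max\{\lceil e^{\frac{3+3\alpha-2\log8}{2+2\alpha}}\rceil,\lceil e^{\frac{2\log8-3-3\alpha}{2+2\alpha}}\rceil,\lceil e^{\frac{3/\pi^2+11(1+\alpha)-6\log8}{6+6\alpha}}\rceil,\lceil e^{\frac{6\log8-11(1+\alpha)-3/\pi^2}{6+6\alpha}}\rceil,\lceil(4+4\alpha)^{227}\rceil,\lceil(12+12\alpha)^{227}\rceil\}$. $N_T(\alpha)=\max\{\widetilde N(\alpha),N_1(\alpha),N_2(\alpha),343361460986\}$. *)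

theory Defs
  imports Complex_Main
begin

text \<open>
  An overpartition of \<open>n\<close> is the list of its parts in non-increasing order. Each part is paired with
  a flag saying whether it is overlined; an overlined part must differ in size from all parts
  preceding it in the list.
\<close>

definition overpartitions :: "nat \<Rightarrow> (nat \<times> bool) list set" where
  "overpartitions n = {xs.
     (\<forall>x \<in> set xs. 0 < fst x) \<and>
     sum_list (map fst xs) = n \<and>
     sorted_wrt (\<lambda>x y. fst x \<ge> fst y) xs \<and>
     sorted_wrt (\<lambda>x y. snd y \<longrightarrow> fst x \<noteq> fst y) xs}"

lemma finite_overpartitions: "finite (overpartitions n)"
proof (rule finite_subset)
  show "overpartitions n \<subseteq> {xs. set xs \<subseteq> {..n} \<times> UNIV \<and> length xs \<le> n}"
  proof
    fix xs assume "xs \<in> overpartitions n"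
    then have pos: "\<forall>x \<in> set xs. 0 < fst x" and sum: "sum_list (map fst xs) = n"
      by (auto simp: overpartitions_def)
    have "length xs \<le> sum_list (map fst xs)"
      using pos by (induction xs) auto
    moreover have "fst x \<le> n" if "x \<in> set xs" for x
      using that member_le_sum_list[of "fst x" "map fst xs"] sum by auto
    ultimately show "xs \<in> {xs. set xs \<subseteq> {..n} \<times> UNIV \<and> length xs \<le> n}"
      using sum by (auto simp: mem_Times_iff)
  qed
  show "finite {xs. set xs \<subseteq> {..n} \<times> (UNIV :: bool set) \<and> length xs \<le> n}"
    by (rule finite_lists_length_le) simp
qed

definition overp :: "nat \<Rightarrow> nat" where
  "overp n = card (overpartitions n)"

definition r_seq :: "real \<Rightarrow> nat \<Rightarrow> real" where
  "r_seq \<alpha> n = root n (real (overp n) / real n powr \<alpha>)"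

definition N_tilde1 :: "real \<Rightarrow> int" where
  "N_tilde1 \<alpha> = Max {\<lceil>sqrt (2 * \<alpha>)\<rceil>, \<lceil>root 3 (3 * \<alpha>)\<rceil>, \<lceil>root 4 (11 * \<alpha> / 3)\<rceil>, \<lceil>root 5 (10 * \<alpha>)\<rceil>}"

definition N_tilde2 :: "real \<Rightarrow> int" where
  "N_tilde2 \<alpha> = Max {2, \<lceil>sqrt (2 * \<alpha>)\<rceil>, \<lceil>root 3 (3 * \<alpha>)\<rceil>, \<lceil>root 4 (11 * \<alpha> / 3)\<rceil>, \<lceil>root 5 (12 * \<alpha>)\<rceil>}"

definition N_tilde3 :: "real \<Rightarrow> int" where
  "N_tilde3 \<alpha> = Max {5505, \<lceil>(4 * \<alpha> / (\<alpha>\<^sup>2 + 1)) powr (4 / 3)\<rceil>, \<lceil>(4 * \<alpha>) powr (4 / 11)\<rceil>}"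

definition N_tilde :: "real \<Rightarrow> int" where
  "N_tilde \<alpha> = Max {N_tilde1 \<alpha>, N_tilde2 \<alpha>, N_tilde3 \<alpha>}"

definition n_u :: "real \<Rightarrow> int" where
  "n_u \<alpha> = Max {
     \<lceil>exp ((6 * \<alpha> + 2 ^ 12 + 2 powr (31 + 18 * \<alpha>)) / (2 + 17 * \<alpha>))\<rceil>,
     \<lceil>(4 + 34 * \<alpha>) ^ 19\<rceil>}"

definition n_l :: "real \<Rightarrow> int" where
  "n_l \<alpha> = Max {
     \<lceil>exp (258 / (80 + 2 powr (16 + 7 * \<alpha>)))\<rceil>,
     \<lceil>(160 + 2 powr (17 + 7 * \<alpha>)) ^ 19\<rceil>}"

definition n_u1 :: "real \<Rightarrow> int" where
  "n_u1 \<alpha> = Max {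
     \<lceil>exp ((12 + 4122 * pi\<^sup>2 - 12 * pi\<^sup>2 * ln 8 + 32 * \<alpha> * pi\<^sup>2 + 2 powr (31 + 18 * \<alpha>) * pi\<^sup>2)
           / (pi\<^sup>2 * (2 + 17 * \<alpha>)))\<rceil>,
     \<lceil>pi ^ 38 * (4 + 34 * \<alpha>) ^ 19\<rceil>}"

definition n_l1 :: "real \<Rightarrow> int" where
  "n_l1 \<alpha> = Max {
     \<lceil>exp ((256 + 105 * (9 * pi\<^sup>2 * (4 + pi\<^sup>2) - 16) / (128 * pi ^ 3))
           / (8 * (3 * \<alpha> + 2 powr (13 + 7 * \<alpha>) + 13)))\<rceil>,
     \<lceil>16 ^ 19 * (3 * \<alpha> + 2 powr (13 + 7 * \<alpha>) + 13) ^ 19\<rceil>}"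

definition N_1 :: "real \<Rightarrow> int" where
  "N_1 \<alpha> = Max {n_u \<alpha>, n_l \<alpha>, n_u1 \<alpha>, n_l1 \<alpha>}"

definition N_2 :: "real \<Rightarrow> int" where
  "N_2 \<alpha> = Max {
     \<lceil>exp ((3 + 3 * \<alpha> - 2 * ln 8) / (2 + 2 * \<alpha>))\<rceil>,
     \<lceil>exp ((2 * ln 8 - 3 - 3 * \<alpha>) / (2 + 2 * \<alpha>))\<rceil>,
     \<lceil>exp ((3 / pi\<^sup>2 + 11 * (1 + \<alpha>) - 6 * ln 8) / (6 + 6 * \<alpha>))\<rceil>,
     \<lceil>exp ((6 * ln 8 - 11 * (1 + \<alpha>) - 3 / pi\<^sup>2) / (6 + 6 * \<alpha>))\<rceil>,
     \<lceil>(4 + 4 * \<alpha>) ^ 227\<rceil>,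
     \<lceil>(12 + 12 * \<alpha>) ^ 227\<rceil>}"

definition N_T :: "real \<Rightarrow> int" where
  "N_T \<alpha> = Max {N_tilde \<alpha>, N_1 \<alpha>, N_2 \<alpha>, 343361460986}"

end

theory Submission
  imports Defs "HOL-Probability.Probability" "HOL-Complex_Analysis.Complex_Analysis"
begin

text \<open>
  Dividing the quartic expression by \<open>(r\<^sub>n r\<^bsub>n+1\<^esub>)\<^sup>2\<close> turns it into \<open>4ab - (a + b + ab)\<^sup>2\<close>, where \<open>1 + a\<close>
  and \<open>1 + b\<close> are the ratios \<open>r\<^bsub>m-1\<^esub> r\<^bsub>m+1\<^esub> / r\<^sub>m\<^sup>2\<close> for \<open>m = n\<close> and \<open>m = n + 1\<close>. So it suffices that
  \<open>r\<close> is strictly log-convex beyond the threshold. With \<open>P = log p\<close>, where \<open>p(n)\<close> counts the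
  overpartitions of \<open>n\<close>, this follows from
  \<open>n\<^sup>2 (P(n+1) + P(n-1) - 2 P(n)) - n (P(n+1) - P(n-1)) + 2 P(n) > 2 \<alpha> log n\<close>.

  The generating function of \<open>p\<close> is \<open>exp (\<Sum>k. c\<^sub>k z\<^sup>k)\<close> with \<open>c\<^sub>k \<ge> 2\<close> for \<open>k \<ge> 1\<close>. Put
  \<open>\<kappa>\<^sub>j = \<Sum>k. k\<^sup>j c\<^sub>k exp (-kt)\<close>, choose \<open>t\<close> with \<open>\<kappa>\<^sub>1 = n\<close> exactly, and express \<open>p(n-1)\<close>, \<open>p(n)\<close>, \<open>p(n+1)\<close> by
  Cauchy's formula on the same circle of radius \<open>exp (-t)\<close>. In the expression above the powers of
  the radius cancel, the factor \<open>exp \<kappa>\<^sub>0\<close> common to all three contributes \<open>2 \<kappa>\<^sub>0\<close>, and a Gaussian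
  approximation of the remaining integrals shows that they contribute at least \<open>- 1.57 n\<^sup>2 / \<kappa>\<^sub>2\<close> up to
  lower order terms. By Cauchy-Schwarz \<open>n\<^sup>2 = \<kappa>\<^sub>1\<^sup>2 \<le> \<kappa>\<^sub>0 \<kappa>\<^sub>2\<close>, which leaves at least \<open>0.4 \<kappa>\<^sub>0\<close>, of order
  \<open>\<surd>n\<close>. Thus crude bounds near and away from the saddle point suffice; neither the modularity of
  the generating function nor an asymptotic formula for \<open>p(n)\<close> enters.
\<close>

section \<open>Overpartitions and their generating function\<close>

definition bounded_overpartitions :: "nat \<Rightarrow> nat \<Rightarrow> (nat \<times> bool) list set" where
  "bounded_overpartitions m n = {xs \<in> overpartitions n. \<forall>x\<in>set xs. fst x \<le> m}"

text \<open>For \<open>m > 0\<close> these are exactly the possible tails behind a leading part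
  \<open>m\<close>: whatever the flag of that part, no later part of the same size may be
  overlined.\<close>

definition plain_overpartitions :: "nat \<Rightarrow> nat \<Rightarrow> (nat \<times> bool) list set" where
  "plain_overpartitions m n = {xs \<in> bounded_overpartitions m n. (m, True) \<notin> set xs}"

lemma finite_bounded_overpartitions: "finite (bounded_overpartitions m n)"
  unfolding bounded_overpartitions_def using finite_overpartitions[of n] by simp

lemma finite_plain_overpartitions: "finite (plain_overpartitions m n)"
  unfolding plain_overpartitions_def using finite_bounded_overpartitions[of m n] by simp

lemma bounded_overpartitions_0: "bounded_overpartitions 0 n = (if n = 0 then {[]} else {})"
proof -
  have "xs = []" if "xs \<in> bounded_overpartitions 0 n" for xs
    using that by (cases xs) (auto simp: bounded_overpartitions_def overpartitions_def)
  moreover have "[] \<in> bounded_overpartitions 0 n \<longleftrightarrow> n = 0"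
    by (auto simp: bounded_overpartitions_def overpartitions_def)
  ultimately show ?thesis by auto
qed

lemma Cons_in_bounded_overpartitions_iff:
  "(Suc m, b) # xs \<in> bounded_overpartitions (Suc m) n \<longleftrightarrow>
     Suc m \<le> n \<and> xs \<in> plain_overpartitions (Suc m) (n - Suc m)"
  unfolding plain_overpartitions_def bounded_overpartitions_def overpartitions_def by fastforce

lemma bounded_overpartitions_cases:
  assumes "xs \<in> bounded_overpartitions (Suc m) n"
  shows "xs \<in> bounded_overpartitions m n \<or> (\<exists>b ys. xs = (Suc m, b) # ys)"
proof (cases xs)
  case Nil
  then show ?thesis using assms by (auto simp: bounded_overpartitions_def)
next
  case (Cons x ys)
  show ?thesis
  proof (cases "fst x = Suc m")
    case True
    then show ?thesis using Cons by (cases x) auto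
  next
    case False
    then have "fst x \<le> m" using assms Cons by (auto simp: bounded_overpartitions_def)
    moreover have "\<forall>y\<in>set ys. fst y \<le> fst x"
      using assms Cons by (auto simp: bounded_overpartitions_def overpartitions_def)
    ultimately show ?thesis using assms Cons
      by (force simp: bounded_overpartitions_def)
  qed
qed

lemma bounded_overpartitions_mono: "bounded_overpartitions m n \<subseteq> bounded_overpartitions (Suc m) n"
  by (auto simp: bounded_overpartitions_def)

lemma Suc_notin_bounded_overpartitions:
  "xs \<in> bounded_overpartitions m n \<Longrightarrow> (Suc m, b) \<notin> set xs"
  by (fastforce simp: bounded_overpartitions_def)

text \<open>Either \<open>Suc m\<close> does not occur or it is the size of the head. The factor 2
  counts the flags of the head, which do not restrict the tail any further.\<close>

lemma card_bounded_overpartitions_Suc: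
  "card (bounded_overpartitions (Suc m) n) = card (bounded_overpartitions m n) +
     (if Suc m \<le> n then 2 * card (plain_overpartitions (Suc m) (n - Suc m)) else 0)"
proof -
  let ?f = "\<lambda>(b, xs). (Suc m, b) # xs"
  let ?P = "if Suc m \<le> n then plain_overpartitions (Suc m) (n - Suc m) else {}"
  have eq: "bounded_overpartitions (Suc m) n =
      bounded_overpartitions m n \<union> ?f ` ((UNIV :: bool set) \<times> ?P)" (is "?L = ?R")
  proof
    show "?L \<subseteq> ?R"
    proof
      fix xs assume xs: "xs \<in> ?L"
      from bounded_overpartitions_cases[OF this] show "xs \<in> ?R"
      proof
        assume "\<exists>b ys. xs = (Suc m, b) # ys"
        then obtain b ys where *: "xs = (Suc m, b) # ys" by blast
        with xs have "ys \<in> ?P" by (simp add: Cons_in_bounded_overpartitions_iff)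
        then show ?thesis using * by force
      qed auto
    qed
    show "?R \<subseteq> ?L"
      using bounded_overpartitions_mono[of m n]
      by (auto simp: Cons_in_bounded_overpartitions_iff split: if_splits)
  qed
  have inj: "inj_on ?f (UNIV \<times> ?P)"
    by (auto simp: inj_on_def)
  have fin: "finite ?P" by (simp add: finite_plain_overpartitions)
  have disj: "bounded_overpartitions m n \<inter> ?f ` (UNIV \<times> ?P) = {}"
  proof -
    have "(Suc m, b) # ys \<notin> bounded_overpartitions m n" for b ys
      using Suc_notin_bounded_overpartitions[of "(Suc m, b) # ys" m n b] by auto
    then show ?thesis by (simp only: disjoint_iff) (auto simp del: UNIV_bool)
  qed
  have "card (?f ` ((UNIV :: bool set) \<times> ?P)) = 2 * card ?P"
    by (simp only: card_image[OF inj] card_cartesian_product card_UNIV_bool)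
  then show ?thesis unfolding eq
    using fin disj by (subst card_Un_disjoint) (auto simp: finite_bounded_overpartitions)
qed

text \<open>Splitting off the head again, but now it cannot be overlined, and the tail is of the
  same kind.\<close>

lemma card_plain_overpartitions_Suc:
  "card (plain_overpartitions (Suc m) n) = card (bounded_overpartitions m n) +
     (if Suc m \<le> n then card (plain_overpartitions (Suc m) (n - Suc m)) else 0)"
proof -
  let ?f = "(#) (Suc m, False)"
  let ?P = "if Suc m \<le> n then plain_overpartitions (Suc m) (n - Suc m) else {}"
  have eq: "plain_overpartitions (Suc m) n = bounded_overpartitions m n \<union> ?f ` ?P" (is "?L = ?R")
  proof
    show "?L \<subseteq> ?R"
    proof
      fix xs assume "xs \<in> ?L"
      then have xs: "xs \<in> bounded_overpartitions (Suc m) n" "(Suc m, True) \<notin> set xs"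
        by (auto simp: plain_overpartitions_def)
      from bounded_overpartitions_cases[OF this(1)] show "xs \<in> ?R"
      proof
        assume "\<exists>b ys. xs = (Suc m, b) # ys"
        then obtain b ys where *: "xs = (Suc m, b) # ys" by blast
        with xs(1) have "ys \<in> ?P" by (simp add: Cons_in_bounded_overpartitions_iff)
        moreover have "\<not> b" using * xs(2) by auto
        ultimately show ?thesis using * by force
      qed auto
    qed
    show "?R \<subseteq> ?L"
      using bounded_overpartitions_mono[of m n] Cons_in_bounded_overpartitions_iff[of m False _ n]
      by (auto simp: plain_overpartitions_def Suc_notin_bounded_overpartitions split: if_splits)
  qed
  have fin: "finite ?P" by (simp add: finite_plain_overpartitions)
  have disj: "bounded_overpartitions m n \<inter> ?f ` ?P = {}"
  proof -
    have "(Suc m, b) # ys \<notin> bounded_overpartitions m n" for b ys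
      using Suc_notin_bounded_overpartitions[of "(Suc m, b) # ys" m n b] by auto
    then show ?thesis by blast
  qed
  have "card (?f ` ?P) = card ?P" by (rule card_image) auto
  then show ?thesis unfolding eq
    using fin disj by (subst card_Un_disjoint) (auto simp: finite_bounded_overpartitions)
qed

lemma overp_eq_card_bounded: "n \<le> m \<Longrightarrow> overp n = card (bounded_overpartitions m n)"
proof -
  assume "n \<le> m"
  have "fst x \<le> n" if "xs \<in> overpartitions n" "x \<in> set xs" for xs x
    using that member_le_sum_list[of "fst x" "map fst xs"] by (auto simp: overpartitions_def)
  with \<open>n \<le> m\<close> have "bounded_overpartitions m n = overpartitions n"
    unfolding bounded_overpartitions_def by fastforce
  then show ?thesis by (simp add: overp_def)
qed

section \<open>Generating functions and their logarithmic derivatives\<close>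

definition bounded_gf :: "nat \<Rightarrow> 'a :: field_char_0 fps" where
  "bounded_gf m = Abs_fps (\<lambda>n. of_nat (card (bounded_overpartitions m n)))"

lemma bounded_gf_0: "bounded_gf 0 = 1"
  by (auto simp: bounded_gf_def fps_eq_iff bounded_overpartitions_0)

text \<open>With \<open>S\<close>, \<open>T\<close> for the series of \<open>m\<close> and
  \<open>Suc m\<close>, and \<open>a = fps_X ^ Suc m\<close>, the two counting recurrences read
  \<open>T = S + 2 * a * U\<close> and \<open>U = S + a * U\<close>. Eliminating \<open>U\<close>
  gives the Euler factor \<open>(1 + a) / (1 - a)\<close>, stated without division.\<close>

lemma bounded_gf_Suc:
  "(1 - fps_X ^ Suc m) * bounded_gf (Suc m) = (1 + fps_X ^ Suc m) * (bounded_gf m :: 'a :: field_char_0 fps)"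
proof -
  define U :: "'a fps" where "U = Abs_fps (\<lambda>n. of_nat (card (plain_overpartitions (Suc m) n)))"
  have 1: "bounded_gf (Suc m) = bounded_gf m + 2 * (fps_X ^ Suc m * U)"
  proof (rule fps_ext)
    fix n
    show "bounded_gf (Suc m) $ n = (bounded_gf m + 2 * (fps_X ^ Suc m * U)) $ n"
      unfolding fps_add_nth fps_X_power_mult_nth
      by (simp add: bounded_gf_def card_bounded_overpartitions_Suc U_def fps_numeral_fps_const
          fps_X_power_mult_nth del: power_Suc)
  qed
  have 2: "U = bounded_gf m + fps_X ^ Suc m * U"
  proof (rule fps_ext)
    fix n
    show "U $ n = (bounded_gf m + fps_X ^ Suc m * U) $ n"
      unfolding fps_add_nth fps_X_power_mult_nth
      by (simp add: bounded_gf_def U_def card_plain_overpartitions_Suc[of m n])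
  qed
  let ?a = "fps_X ^ Suc m :: 'a fps"
  have "(1 - ?a) * bounded_gf (Suc m) = (1 - ?a) * bounded_gf m + 2 * ?a * ((1 - ?a) * U)"
    unfolding 1 by (simp only: algebra_simps)
  also have "(1 - ?a) * U = bounded_gf m"
    using 2 by (simp add: algebra_simps del: power_Suc)
  finally show ?thesis by (simp add: algebra_simps del: power_Suc)
qed

text \<open>For \<open>i > 0\<close> this is the expansion of
  \<open>2 * i * x ^ i / (1 - x ^ (2 * i))\<close>, which is \<open>x\<close> times the logarithmic
  derivative of \<open>(1 + x ^ i) / (1 - x ^ i)\<close>.\<close>

definition lambert_term :: "nat \<Rightarrow> 'a :: field_char_0 fps" where
  "lambert_term i = Abs_fps (\<lambda>k. if i dvd k \<and> odd (k div i) then 2 * of_nat i else 0)"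

lemma lambert_term_mult:
  assumes "i > 0"
  shows "lambert_term i * (1 - fps_X ^ (2 * i)) = (2 * of_nat i * fps_X ^ i :: 'a :: field_char_0 fps)"
proof (rule fps_ext)
  fix k
  have L: "(lambert_term i * (1 - fps_X ^ (2 * i))) $ k =
      (lambert_term i :: 'a fps) $ k - (if k < 2 * i then 0 else lambert_term i $ (k - 2 * i))"
    by (simp only: right_diff_distrib mult_1_right fps_sub_nth fps_X_power_mult_right_nth)
  have "(lambert_term i :: 'a fps) $ k - (if k < 2 * i then 0 else lambert_term i $ (k - 2 * i))
      = (if k = i then 2 * of_nat i else 0)"
  proof (cases "k < 2 * i")
    case True
    have "i dvd k \<and> odd (k div i) \<longleftrightarrow> k = i"
    proof
      assume *: "i dvd k \<and> odd (k div i)"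
      then obtain j where "k = i * j" by auto
      with * True assms have "odd j" "j < 2" by auto
      then have "j = 1" by presburger
      with \<open>k = i * j\<close> show "k = i" by simp
    qed (use assms in auto)
    then show ?thesis using True by (simp add: lambert_term_def)
  next
    case False
    then obtain l where l: "k = l + 2 * i" by (metis add.commute le_Suc_ex not_less)
    have "i dvd k \<longleftrightarrow> i dvd l" unfolding l by simp
    moreover have "k div i = l div i + 2" unfolding l using assms by simp
    ultimately show ?thesis using l assms by (auto simp: lambert_term_def)
  qed
  moreover have "(2 * of_nat i * fps_X ^ i :: 'a fps) $ k = (if k = i then 2 * of_nat i else 0)"
    by (simp add: fps_X_power_mult_right_nth mult.assoc fps_numeral_fps_const fps_of_nat[symmetric])
  ultimately show "(lambert_term i * (1 - fps_X ^ (2 * i))) $ k = (2 * of_nat i * fps_X ^ i :: 'a fps) $ k"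
    using L by simp
qed

text \<open>Logarithmic differentiation turns the product of the Euler factors into a sum: each
  induction step contributes one Lambert term.\<close>

lemma bounded_gf_log_deriv:
  "fps_X * fps_deriv (bounded_gf m) = bounded_gf m * (\<Sum>i=1..m. lambert_term i :: 'a :: field_char_0 fps)"
proof (induction m)
  case 0
  then show ?case by (simp add: bounded_gf_0)
next
  case (Suc m)
  define a where "a = (fps_X ^ Suc m :: 'a fps)"
  define S T L where "S = (bounded_gf m :: 'a fps)" "T = (bounded_gf (Suc m) :: 'a fps)"
    "L = (\<Sum>i=1..m. lambert_term i :: 'a fps)"
  define M where "M = (of_nat (Suc m) :: 'a fps)"
  have rec: "(1 - a) * T = (1 + a) * S"
    using bounded_gf_Suc[of m] unfolding a_def S_T_L_def .
  have IH: "fps_X * fps_deriv S = S * L" using Suc.IH unfolding S_T_L_def .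
  have Da: "fps_X * fps_deriv a = M * a"
    unfolding a_def M_def fps_deriv_power' by (simp add: algebra_simps del: of_nat_Suc)
  have "(1 - a) * (fps_X * fps_deriv T) - (fps_X * fps_deriv a) * T = fps_X * fps_deriv ((1 - a) * T)"
    by (simp add: algebra_simps)
  also have "\<dots> = (1 + a) * (fps_X * fps_deriv S) + (fps_X * fps_deriv a) * S"
    unfolding rec by (simp add: algebra_simps)
  finally have "(1 - a) * (fps_X * fps_deriv T) = M * a * T + M * a * S + (1 + a) * S * L"
    unfolding Da IH by (simp only: diff_eq_eq) (simp only: algebra_simps)
  \<comment> \<open>The extra factor \<open>1 + a\<close> makes \<open>(1 + a) * S\<close> appear,
    which \<open>rec\<close> replaces by \<open>(1 - a) * T\<close>. The common factor
    \<open>(1 + a) * (1 - a)\<close> has constant term 1 and is cancelled at the end.\<close>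
  then have "(1 + a) * ((1 - a) * (fps_X * fps_deriv T))
      = (1 + a) * (M * a * T + M * a * S + (1 + a) * S * L)"
    by (rule arg_cong)
  also have "\<dots> = (1 + a) * M * a * T + M * a * ((1 + a) * S) + (1 + a) * ((1 + a) * S) * L"
    by (simp only: algebra_simps)
  also have "\<dots> = 2 * M * a * T + (1 + a) * (1 - a) * T * L"
    unfolding rec[symmetric] by (simp add: algebra_simps)
  also have "2 * M * a = lambert_term (Suc m) * ((1 + a) * (1 - a))"
  proof -
    have "(1 + a) * (1 - a) = 1 - fps_X ^ (2 * Suc m)"
      unfolding a_def power_mult mult.commute[of 2] power2_eq_square by (simp only: algebra_simps mult_1_left)
    then show ?thesis using lambert_term_mult[of "Suc m", where 'a = 'a]
      unfolding M_def a_def[symmetric] by (simp only: zero_less_Suc)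
  qed
  finally have "((1 + a) * (1 - a)) * (fps_X * fps_deriv T) = ((1 + a) * (1 - a)) * (T * (lambert_term (Suc m) + L))"
    by (simp add: algebra_simps)
  moreover have "(1 + a) * (1 - a) \<noteq> 0"
  proof -
    have "((1 + a) * (1 - a)) $ 0 = 1" by (simp add: a_def)
    then show ?thesis by (metis fps_zero_nth zero_neq_one)
  qed
  ultimately have "fps_X * fps_deriv T = T * (lambert_term (Suc m) + L)" by simp
  then show ?case unfolding S_T_L_def by (simp add: add.commute)
qed

text \<open>The coefficients of \<open>\<Sum>i\<ge>1. log ((1 + x ^ i) / (1 - x ^ i)) = \<Sum>i\<ge>1. \<Sum>m odd. 2 / m * x ^ (i * m)\<close>.\<close>
definition log_coeff :: "nat \<Rightarrow> real" where
  "log_coeff k = (\<Sum>i | i dvd k \<and> odd (k div i). 2 * real i) / real k"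

lemma log_coeff_0 [simp]: "log_coeff 0 = 0"
  by (simp add: log_coeff_def)

lemma overp_0: "overp 0 = 1"
  by (simp add: overp_eq_card_bounded[of 0 0] bounded_overpartitions_0)

text \<open>Comparison of the coefficients of \<open>x ^ n\<close> in
  \<open>bounded_gf_log_deriv\<close> with the bound \<open>m = n\<close>: up to this degree larger
  parts contribute nothing.\<close>

lemma overp_recurrence:
  "real n * real (overp n) = (\<Sum>k\<le>n. real k * log_coeff k * real (overp (n - k)))"
proof -
  have lam: "(\<Sum>i=1..n. (lambert_term i :: real fps)) $ k = real k * log_coeff k" if "k \<le> n" for k
  proof (cases "k = 0")
    case True
    then show ?thesis by (simp add: fps_sum_nth lambert_term_def)
  next
    case False
    have *: "{i. i dvd k \<and> odd (k div i)} = {i \<in> {1..n}. i dvd k \<and> odd (k div i)}"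
      using that False by (auto dest: dvd_imp_le intro!: Suc_leI Nat.gr0I)
    have "(\<Sum>i=1..n. (lambert_term i :: real fps)) $ k
        = (\<Sum>i=1..n. if i dvd k \<and> odd (k div i) then 2 * real i else 0)"
      by (simp add: fps_sum_nth lambert_term_def)
    also have "\<dots> = (\<Sum>i | i dvd k \<and> odd (k div i). 2 * real i)"
      unfolding * by (rule sum.inter_filter[symmetric]) simp
    finally show ?thesis using False by (simp add: log_coeff_def)
  qed
  have "real n * real (overp n) = (fps_X * fps_deriv (bounded_gf n :: real fps)) $ n"
    by (cases n) (auto simp: bounded_gf_def overp_eq_card_bounded)
  also have "\<dots> = ((\<Sum>i=1..n. lambert_term i) * bounded_gf n) $ n"
    by (simp add: bounded_gf_log_deriv mult.commute)
  also have "\<dots> = (\<Sum>k\<le>n. (\<Sum>i=1..n. lambert_term i :: real fps) $ k * bounded_gf n $ (n - k))"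
    by (simp add: fps_mult_nth atLeast0AtMost)
  also have "\<dots> = (\<Sum>k\<le>n. real k * log_coeff k * real (overp (n - k)))"
  proof (intro sum.cong refl)
    fix k assume "k \<in> {..n}"
    then show "(\<Sum>i=1..n. lambert_term i :: real fps) $ k * bounded_gf n $ (n - k)
        = real k * log_coeff k * real (overp (n - k))"
      using lam[of k] overp_eq_card_bounded[of "n - k" n] by (simp add: bounded_gf_def)
  qed
  finally show ?thesis .
qed

text \<open>For \<open>E = exp C\<close> the chain rule gives \<open>E' = C' * E\<close>; comparing
  coefficients yields a recurrence of the same shape as \<open>overp_recurrence\<close>.\<close>

lemma fps_exp_compose_recurrence:
  fixes C :: "complex fps"
  assumes "C $ 0 = 0"
  shows "of_nat n * (fps_exp 1 oo C) $ n = (\<Sum>k\<le>n. of_nat k * C $ k * (fps_exp 1 oo C) $ (n - k))"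
proof (cases n)
  case 0
  then show ?thesis by simp
next
  case (Suc m)
  let ?E = "fps_exp 1 oo C"
  have "fps_deriv ?E = fps_deriv C * ?E"
    using assms by (simp add: fps_compose_deriv mult.commute)
  then have "fps_X * fps_deriv ?E = (fps_X * fps_deriv C) * ?E" by (simp add: mult.assoc)
  then have "(fps_X * fps_deriv ?E) $ n = ((fps_X * fps_deriv C) * ?E) $ n" by (rule arg_cong)
  also have "\<dots> = (\<Sum>k\<le>n. (fps_X * fps_deriv C) $ k * ?E $ (n - k))"
    by (simp only: fps_mult_nth atLeast0AtMost)
  also have "\<dots> = (\<Sum>k\<le>n. of_nat k * C $ k * ?E $ (n - k))"
    by (intro sum.cong refl) (auto simp: fps_X_mult_nth)
  finally show ?thesis using Suc by simp
qed

text \<open>Both sides start with 1 and obey the same recurrence. Its term for \<open>k = 0\<close>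
  vanishes, so for \<open>n > 0\<close> the value at \<open>n\<close> is determined by smaller
  indices.\<close>

lemma overp_eq_fps_exp:
  "of_nat (overp n) = (fps_exp 1 oo Abs_fps (\<lambda>k. complex_of_real (log_coeff k))) $ n"
proof (induction n rule: less_induct)
  case (less n)
  let ?C = "Abs_fps (\<lambda>k. complex_of_real (log_coeff k))"
  show ?case
  proof (cases "n = 0")
    case True
    then show ?thesis by (simp add: overp_0)
  next
    case False
    have "of_nat n * of_nat (overp n) = complex_of_real (real n * real (overp n))" by simp
    also have "\<dots> = (\<Sum>k\<le>n. of_nat k * ?C $ k * of_nat (overp (n - k)))"
      by (simp add: overp_recurrence)
    also have "\<dots> = (\<Sum>k\<le>n. of_nat k * ?C $ k * (fps_exp 1 oo ?C) $ (n - k))"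
    proof (intro sum.cong refl)
      fix k
      show "of_nat k * ?C $ k * of_nat (overp (n - k)) = of_nat k * ?C $ k * (fps_exp 1 oo ?C) $ (n - k)"
        using less.IH[of "n - k"] False by (cases "k = 0") auto
    qed
    also have "\<dots> = of_nat n * (fps_exp 1 oo ?C) $ n"
      by (rule fps_exp_compose_recurrence[symmetric]) simp
    finally show ?thesis using False by simp
  qed
qed

text \<open>The divisor \<open>i = k\<close>, whose cofactor 1 is odd, alone contributes
  \<open>2 * k\<close> to the sum.\<close>

lemma log_coeff_ge_2:
  assumes "k > 0" shows "log_coeff k \<ge> 2"
proof -
  have "2 * real k = (\<Sum>i\<in>{k}. 2 * real i)" by simp
  also have "\<dots> \<le> (\<Sum>i | i dvd k \<and> odd (k div i). 2 * real i)"
    using assms by (intro sum_mono2) auto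
  finally show ?thesis using assms by (simp add: log_coeff_def field_simps)
qed

lemma log_coeff_nonneg: "log_coeff k \<ge> 0"
  using log_coeff_ge_2[of k] by (cases "k = 0") auto

section \<open>Cumulants and the integral representation\<close>

lemma sum_inverse_squares_le: "(\<Sum>m=1..K. 1 / (real m)\<^sup>2) \<le> 2"
proof -
  \<comment> \<open>The induction needs the sharper bound with \<open>1 / K\<close> subtracted,
    which telescopes.\<close>
  have "(\<Sum>m=1..K. 1 / (real m)\<^sup>2) \<le> 2 - 1 / real K" if "K \<ge> 1" for K
    using that
  proof (induction K rule: nat_induct_at_least)
    case (Suc K)
    have "1 / (real (Suc K))\<^sup>2 \<le> 1 / real K - 1 / real (Suc K)"
      using Suc.hyps by (simp add: divide_simps power2_eq_square)
    with Suc.IH show ?case by simp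
  qed simp_all
  from this[of K] show ?thesis
    by (cases "K = 0") (force intro: order_trans)+
qed

lemma log_coeff_eq_sum_divisors:
  assumes "k > 0"
  shows "log_coeff k = (\<Sum>i | i dvd k \<and> odd (k div i). 2 / real (k div i))"
proof -
  have "2 * real i / real k = 2 / real (k div i)" if "i dvd k" for i
    using that assms by (auto simp: real_of_nat_div)
  then show ?thesis unfolding log_coeff_def sum_divide_distrib
    by (intro sum.cong) auto
qed

lemma geometric_exp_sum_le:
  assumes "y > 0" shows "(\<Sum>i=1..K. exp (- y * real i)) \<le> 1 / y"
proof -
  define x where "x = exp (- y)"
  have x: "0 < x" "x < 1" using assms by (auto simp: x_def)
  have "(\<Sum>i=1..K. exp (- y * real i)) = (\<Sum>i=1..K. x ^ i)"
    unfolding x_def by (simp add: exp_of_nat_mult[symmetric] mult.commute)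
  also have "\<dots> = (x - x ^ Suc K) / (1 - x)"
    using x by (subst sum_gp) (auto simp: not_less)
  also have "\<dots> \<le> x / (1 - x)" using x by (intro divide_right_mono) auto
  also have "\<dots> \<le> 1 / y"
  proof -
    have "(1 + y) * x \<le> exp y * x" using x by (intro mult_right_mono) auto
    also have "\<dots> = 1" by (simp add: x_def exp_minus)
    finally show ?thesis using x assms by (simp add: field_simps)
  qed
  finally show ?thesis .
qed

definition weight :: "real \<Rightarrow> nat \<Rightarrow> real" where
  "weight t k = log_coeff k * exp (- t * real k)"

lemma weight_nonneg: "weight t k \<ge> 0"
  by (simp add: weight_def log_coeff_nonneg)

text \<open>Writing \<open>k = i * m\<close> with \<open>m\<close> odd produces a double sum, which
  is majorised by the sum over all pairs in a square. The sum over \<open>i\<close> is geometric and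
  at most \<open>1 / (t * m)\<close>; the remaining sum over \<open>m\<close> is one of inverse
  squares.\<close>

lemma sum_weight_le:
  assumes "t > 0"
  shows "(\<Sum>k<K. weight t k) \<le> 4 / t"
proof -
  let ?Sq = "{1..K} \<times> {1..K}"
  let ?f = "\<lambda>(i, m). 2 / real m * exp (- t * real (i * m))"
  have pt: "weight t k \<le> (\<Sum>p\<in>?Sq. if fst p * snd p = k then ?f p else 0)" if "k < K" for k
  proof (cases "k = 0")
    case True
    then show ?thesis by (auto simp: weight_def intro!: sum_nonneg)
  next
    case False
    let ?D = "{i. i dvd k \<and> odd (k div i)}"
    have "weight t k = (\<Sum>i\<in>?D. ?f (i, k div i))"
      using False by (auto simp: weight_def log_coeff_eq_sum_divisors sum_distrib_right intro!: sum.cong)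
    also have "\<dots> = sum ?f ((\<lambda>i. (i, k div i)) ` ?D)"
      by (subst sum.reindex) (auto simp: inj_on_def)
    also have "\<dots> \<le> sum ?f {p \<in> ?Sq. fst p * snd p = k}"
    proof (rule sum_mono2)
      show "(\<lambda>i. (i, k div i)) ` ?D \<subseteq> {p \<in> ?Sq. fst p * snd p = k}"
      proof (clarsimp)
        fix i assume i: "i dvd k" "odd (k div i)"
        have "i \<le> k" using i False by (auto dest: dvd_imp_le)
        moreover have "k div i \<le> k" by simp
        moreover have "i > 0" "k div i > 0" using i False by (auto intro: Nat.gr0I elim: oddE)
        ultimately show "Suc 0 \<le> i \<and> i \<le> K \<and> Suc 0 \<le> k div i \<and> k div i \<le> K"
          using that by linarith
      qed
    qed auto
    also have "\<dots> = (\<Sum>p\<in>?Sq. if fst p * snd p = k then ?f p else 0)"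
      by (rule sum.inter_filter) simp
    finally show ?thesis .
  qed
  have "(\<Sum>k<K. weight t k) \<le> (\<Sum>k<K. \<Sum>p\<in>?Sq. if fst p * snd p = k then ?f p else 0)"
    by (intro sum_mono pt) auto
  also have "\<dots> = (\<Sum>p\<in>?Sq. \<Sum>k<K. if fst p * snd p = k then ?f p else 0)"
    by (rule sum.swap)
  also have "\<dots> \<le> (\<Sum>p\<in>?Sq. ?f p)"
    by (intro sum_mono) (auto simp: sum.delta)
  also have "\<dots> = (\<Sum>i=1..K. \<Sum>m=1..K. 2 / real m * exp (- t * real (i * m)))"
    by (simp add: sum.cartesian_product)
  also have "\<dots> = (\<Sum>m=1..K. \<Sum>i=1..K. 2 / real m * exp (- t * real (i * m)))"
    by (rule sum.swap)
  also have "\<dots> = (\<Sum>m=1..K. 2 / real m * (\<Sum>i=1..K. exp (- (t * real m) * real i)))"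
    by (simp add: sum_distrib_left mult_ac)
  also have "\<dots> \<le> (\<Sum>m=1..K. 2 / real m * (1 / (t * real m)))"
    using assms by (intro sum_mono mult_left_mono geometric_exp_sum_le) auto
  also have "\<dots> = 2 / t * (\<Sum>m=1..K. 1 / (real m)\<^sup>2)"
    by (simp add: sum_distrib_left power2_eq_square field_simps)
  also have "\<dots> \<le> 2 / t * 2" using assms by (intro mult_left_mono sum_inverse_squares_le) auto
  finally show ?thesis by simp
qed

lemma power_le_fact_exp: "x \<ge> 0 \<Longrightarrow> x ^ j \<le> fact j * exp (x :: real)"
proof -
  assume "x \<ge> 0"
  have "(\<lambda>n. x ^ n /\<^sub>R fact n) sums exp x" by (rule exp_converges)
  moreover from this have "(\<Sum>n\<in>{j}. x ^ n /\<^sub>R fact n) \<le> (\<Sum>n. x ^ n /\<^sub>R fact n)"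
    using \<open>x \<ge> 0\<close> by (intro sum_le_suminf) (auto simp: sums_iff)
  ultimately have "(\<Sum>n\<in>{j}. x ^ n /\<^sub>R fact n) \<le> exp x" by (simp add: sums_iff)
  then show ?thesis by (simp add: field_simps)
qed

text \<open>Half of the exponential decay pays for the power of \<open>k\<close>; the other half
  remains as the weight at \<open>t / 2\<close>.\<close>

lemma power_weight_le:
  assumes "t > 0"
  shows "real k ^ j * weight t k \<le> fact j * (2 / t) ^ j * weight (t / 2) k"
proof -
  have "(t / 2 * real k) ^ j \<le> fact j * exp (t / 2 * real k)"
    using assms by (intro power_le_fact_exp) auto
  then have "real k ^ j \<le> fact j * (2 / t) ^ j * exp (t / 2 * real k)"
    using assms by (simp add: power_mult_distrib power_divide field_simps)
  then have "real k ^ j * weight t k \<le> fact j * (2 / t) ^ j * exp (t / 2 * real k) * weight t k"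
    by (rule mult_right_mono) (rule weight_nonneg)
  also have "\<dots> = fact j * (2 / t) ^ j * weight (t / 2) k"
    by (simp add: weight_def exp_add[symmetric] mult.assoc mult.left_commute[of _ "log_coeff k"])
  finally show ?thesis .
qed

text \<open>Up to the sign \<open>(- 1) ^ j\<close> this is the \<open>j\<close>-th derivative in
  \<open>t\<close> of the logarithm of the generating function at \<open>exp (- t)\<close>. For
  \<open>j \<ge> 1\<close> it is the \<open>j\<close>-th cumulant of the law on the natural numbers
  with weights proportional to \<open>overp n * exp (- t * n)\<close>.\<close>

definition cumulant :: "nat \<Rightarrow> real \<Rightarrow> real" where
  "cumulant j t = (\<Sum>k. real k ^ j * weight t k)"

lemma summable_weight: "t > 0 \<Longrightarrow> summable (weight t)"
  by (rule bounded_imp_summable[of _ "4 / t"])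
     (use sum_weight_le[of t "Suc _"] in \<open>auto simp: weight_nonneg lessThan_Suc_atMost\<close>)

lemma summable_power_weight:
  assumes "t > 0" shows "summable (\<lambda>k. real k ^ j * weight t k)"
proof (rule summable_comparison_test')
  show "summable (\<lambda>k. fact j * (2 / t) ^ j * weight (t / 2) k)"
    using assms by (intro summable_mult summable_weight) auto
  show "norm (real k ^ j * weight t k) \<le> fact j * (2 / t) ^ j * weight (t / 2) k" if "k \<ge> 0" for k
    using power_weight_le[OF assms, of k j] by (simp add: weight_nonneg)
qed

lemma cumulant_le:
  assumes "t > 0" shows "cumulant j t \<le> fact j * (2 / t) ^ j * (8 / t)"
proof -
  have "cumulant j t \<le> (\<Sum>k. fact j * (2 / t) ^ j * weight (t / 2) k)"
    unfolding cumulant_def using assms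
    by (intro suminf_le power_weight_le summable_power_weight summable_mult summable_weight) auto
  also have "\<dots> = fact j * (2 / t) ^ j * (\<Sum>k. weight (t / 2) k)"
    using assms by (intro suminf_mult summable_weight) auto
  also have "(\<Sum>k. weight (t / 2) k) \<le> 8 / t"
    using assms sum_weight_le[of "t / 2"] by (intro suminf_le_const summable_weight) auto
  finally show ?thesis using assms by (simp add: mult_left_mono)
qed

lemma cumulant_nonneg: "t > 0 \<Longrightarrow> cumulant j t \<ge> 0"
  unfolding cumulant_def by (intro suminf_nonneg summable_power_weight) (auto simp: weight_nonneg)

section \<open>Cauchy's formula for overpartition numbers\<close>

definition log_gf :: "complex fps" where
  "log_gf = Abs_fps (\<lambda>k. complex_of_real (log_coeff k))"

lemma fps_conv_radius_log_gf: "fps_conv_radius log_gf \<ge> 1"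
  unfolding fps_conv_radius_def
proof (rule conv_radius_geI_ex')
  fix r :: real assume r: "0 < r" "ereal r < 1"
  then have "summable (weight (- ln r))" by (intro summable_weight) auto
  moreover have "weight (- ln r) = (\<lambda>k. log_coeff k * r ^ k)"
    using r by (auto simp: weight_def exp_of_nat2_mult)
  ultimately have "summable (\<lambda>k. log_coeff k * r ^ k)" by simp
  then have "summable (\<lambda>k. complex_of_real (log_coeff k * r ^ k))"
    by (rule summable_of_real)
  then show "summable (\<lambda>k. fps_nth log_gf k * complex_of_real r ^ k)"
    by (simp add: log_gf_def)
qed

lemma holomorphic_log_gf: "eval_fps log_gf holomorphic_on ball 0 1"
proof -
  have "ball 0 1 \<subseteq> eball (0 :: complex) (fps_conv_radius log_gf)"
    by (auto simp: eball_def intro!: less_le_trans[OF _ fps_conv_radius_log_gf])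
  then show ?thesis
    by (intro holomorphic_intros) auto
qed

lemma sums_log_gf:
  assumes "t > 0"
  shows "(\<lambda>k. weight t k * cis (real k * \<theta>)) sums eval_fps log_gf (complex_of_real (exp (- t)) * cis \<theta>)"
proof -
  have "ereal (norm (complex_of_real (exp (- t)) * cis \<theta>)) < fps_conv_radius log_gf"
    using assms fps_conv_radius_log_gf by (intro less_le_trans[OF _ fps_conv_radius_log_gf]) (auto simp: norm_mult)
  from sums_eval_fps[OF this] have "(\<lambda>k. log_gf $ k * (complex_of_real (exp (- t)) * cis \<theta>) ^ k) sums
      eval_fps log_gf (complex_of_real (exp (- t)) * cis \<theta>)" .
  moreover have "log_gf $ k * (complex_of_real (exp (- t)) * cis \<theta>) ^ k = weight t k * cis (real k * \<theta>)" for k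
  proof -
    have "exp (- t * real k) = exp (- t) ^ k" by (rule exp_of_nat2_mult)
    then show ?thesis
      by (simp only: log_gf_def weight_def power_mult_distrib Complex.DeMoivre of_real_mult of_real_power
          fps_nth_Abs_fps mult.assoc)
  qed
  ultimately show ?thesis by simp
qed

lemma overp_integral:
  assumes "t > 0"
  shows "((\<lambda>\<theta>. exp (eval_fps log_gf (complex_of_real (exp (- t)) * cis \<theta>)) * cis (- real m * \<theta>)) has_integral
           of_real (2 * pi * exp (- t * real m) * real (overp m))) {- pi..pi}"
proof -
  define F where "F = (\<lambda>z. exp (eval_fps log_gf z))"
  define r where "r = exp (- t)"
  have r: "0 < r" "r < 1" using assms by (auto simp: r_def)
  have holF: "F holomorphic_on ball 0 1"
    unfolding F_def by (intro holomorphic_intros holomorphic_on_compose_gen[OF holomorphic_log_gf, of exp UNIV, unfolded o_def]) auto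
  have "(exp \<circ> eval_fps log_gf) has_fps_expansion (fps_exp 1 oo log_gf)"
  proof (rule has_fps_expansion_compose)
    show "eval_fps log_gf has_fps_expansion log_gf"
      by (rule eval_fps_has_fps_expansion) (rule less_le_trans[OF _ fps_conv_radius_log_gf], simp)
    show "log_gf $ 0 = 0" by (simp add: log_gf_def)
  qed (rule has_fps_expansion_exp1)
  then have "F has_fps_expansion (fps_exp 1 oo log_gf)" by (simp add: F_def o_def)
  from fps_nth_fps_expansion[OF this, of m]
  have der: "(deriv ^^ m) F 0 = fact m * of_nat (overp m)"
    using overp_eq_fps_exp[of m] by (simp add: log_gf_def field_simps)
  \<comment> \<open>The circle path runs over angles from 0 to \<open>2 * pi\<close>. Moving it to
    the symmetric interval turns \<open>cis s\<close> into \<open>- cis s\<close>, and the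
    reflection in \<open>h\<close> compensates for this.\<close>
  define h where "h = (\<lambda>z. F (- 1 * z))"
  have derh: "(deriv ^^ m) h 0 = (- 1) ^ m * (fact m * of_nat (overp m))"
    unfolding h_def
    by (subst higher_deriv_compose_linear[OF holF, where S = "ball 0 1"]) (auto simp: der)
  have holh: "h holomorphic_on ball 0 1"
    unfolding h_def by (rule holomorphic_on_compose_gen[OF _ holF, unfolded o_def]) (auto intro!: holomorphic_intros)
  have sub: "cball 0 r \<subseteq> ball (0 :: complex) 1" using r by auto
  have "((\<lambda>u. h u / (u - 0) ^ Suc m) has_contour_integral (2 * pi * \<i>) / fact m * (deriv ^^ m) h 0) (circlepath 0 r)"
  proof (rule Cauchy_has_contour_integral_higher_derivative_circlepath)
    show "continuous_on (cball 0 r) h"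
      using holomorphic_on_subset[OF holh sub] by (rule holomorphic_on_imp_continuous_on)
    show "h holomorphic_on ball 0 r" using r by (intro holomorphic_on_subset[OF holh]) auto
  qed (use r in auto)
  then have "((\<lambda>s. h (0 + r * cis s) / (0 + r * cis s - 0) ^ Suc m * r * \<i> * cis s) has_integral
      (2 * pi * \<i>) / fact m * (deriv ^^ m) h 0) {0..2 * pi}"
    unfolding circlepath_def by (subst (asm) has_contour_integral_part_circlepath_iff) auto
  from has_integral_affinity'[of _ _ 0 "2 * pi" 1 pi, simplified, OF this[simplified]]
  have "((\<lambda>s. h (r * cis (s + pi)) / (r * cis (s + pi)) ^ Suc m * r * \<i> * cis (s + pi)) has_integral
      (2 * pi * \<i>) * ((- 1) ^ m * of_nat (overp m))) {- pi..pi}"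
    using derh by (simp add: mult.assoc)
  from has_integral_mult_right[OF this, of "of_real (r ^ m) * (- 1) ^ m / \<i>"]
  have "((\<lambda>s. of_real (r ^ m) * (- 1) ^ m / \<i> * (h (r * cis (s + pi)) / (r * cis (s + pi)) ^ Suc m * r * \<i> * cis (s + pi))) has_integral
      of_real (r ^ m) * (- 1) ^ m / \<i> * ((2 * pi * \<i>) * ((- 1) ^ m * of_nat (overp m)))) {- pi..pi}" .
  moreover have "of_real (r ^ m) * (- 1) ^ m / \<i> * ((2 * pi * \<i>) * ((- 1) ^ m * of_nat (overp m)))
      = complex_of_real (2 * pi * r ^ m * real (overp m))"
  proof -
    have "(- 1) ^ m * (- 1) ^ m = (1 :: complex)" by (simp flip: power_mult_distrib)
    moreover have "R * e / \<i> * ((2 * P * \<i>) * (e * Q)) = (e * e) * (2 * P * R * Q)" for R e P Q :: complex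
      by (simp add: field_simps)
    ultimately show ?thesis by (simp only: mult_1_left of_real_mult of_real_of_nat_eq of_real_numeral)
  qed
  moreover have "of_real (r ^ m) * (- 1) ^ m / \<i> * (h (r * cis (s + pi)) / (r * cis (s + pi)) ^ Suc m * r * \<i> * cis (s + pi))
      = F (r * cis s) * cis (- real m * s)" for s
  proof -
    have c: "cis (s + pi) = - cis s" by (simp add: cis.ctr complex_eq_iff)
    have h: "h (r * cis (s + pi)) = F (r * cis s)" by (simp add: h_def c)
    have pw: "(r * cis (s + pi)) ^ Suc m = of_real (r ^ m) * (- 1) ^ m * cis s ^ m * (r * cis (s + pi))"
      unfolding c by (simp add: power_mult_distrib power_minus[of "of_real r * cis s" m])
    have cm: "cis (- real m * s) = 1 / cis s ^ m"
      by (simp add: Complex.DeMoivre cis_divide[of 0, simplified])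
    have cancel: "R * e / i * (G / (R * e * c * (x * y)) * x * i * y) = G * (1 / c)"
      if "i \<noteq> 0" "e * e = 1" "R \<noteq> 0" "c \<noteq> 0" "x \<noteq> 0" "y \<noteq> 0" for R e G c x y i :: complex
    proof -
      have "e \<noteq> 0" using that by auto
      then show ?thesis using that by (simp add: divide_simps)
    qed
    show ?thesis unfolding pw cm h
      by (rule cancel) (use r in \<open>auto simp flip: power_mult_distrib\<close>)
  qed
  ultimately have "((\<lambda>s. F (r * cis s) * cis (- real m * s)) has_integral
      complex_of_real (2 * pi * r ^ m * real (overp m))) {- pi..pi}"
    by (simp only:)
  moreover have "exp (- t * real m) = r ^ m" unfolding r_def by (rule exp_of_nat2_mult)
  ultimately show ?thesis by (simp only: F_def r_def)
qed

section \<open>Modulus and argument of the generating function on the circle\<close>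

definition damping :: "real \<Rightarrow> real \<Rightarrow> real" where
  "damping t \<theta> = (\<Sum>k. weight t k * (1 - cos (real k * \<theta>)))"

text \<open>At \<open>exp (- t) * cis \<theta>\<close> the generating function has modulus
  \<open>exp (cumulant 0 t - damping t \<theta>)\<close> and argument
  \<open>phase t \<theta> + cumulant 1 t * \<theta>\<close>. The linear part is split off because
  the Cauchy kernel cancels it when \<open>cumulant 1 t\<close> is the index of the
  coefficient.\<close>

definition phase :: "real \<Rightarrow> real \<Rightarrow> real" where
  "phase t \<theta> = (\<Sum>k. weight t k * (sin (real k * \<theta>) - real k * \<theta>))"

lemma one_minus_cos_le: "1 - cos x \<le> x\<^sup>2 / 2" for x :: real
proof -
  have "1 - cos x = 2 * (sin (x / 2))\<^sup>2"
    using cos_double_sin[of "x / 2"] by simp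
  also have "(sin (x / 2))\<^sup>2 \<le> (x / 2)\<^sup>2"
    using abs_sin_x_le_abs_x[of "x / 2"] abs_le_square_iff by blast
  finally show ?thesis by (simp add: power2_eq_square)
qed

lemma one_minus_cos_ge: "1 - cos x \<ge> x\<^sup>2 / 2 - x ^ 4 / 24" for x :: real
proof -
  obtain s where s: "cos x = (\<Sum>m<4. cos_coeff m * x ^ m) + (cos (s + 1/2 * real 4 * pi) / fact 4) * x ^ 4"
    using Maclaurin_cos_expansion[of x 4] by blast
  have "(\<Sum>m<4. cos_coeff m * x ^ m) = 1 - x\<^sup>2 / 2"
    by (simp add: lessThan_nat_numeral cos_coeff_def power2_eq_square)
  moreover have "(cos (s + 1/2 * real 4 * pi) / fact 4) * x ^ 4 \<le> (1 / fact 4) * x ^ 4"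
    by (intro mult_right_mono divide_right_mono) auto
  ultimately show ?thesis using s by (simp add: fact_numeral)
qed

context
  fixes t :: real assumes t: "t > 0"
begin

lemma summable_weight_cos: "summable (\<lambda>k. weight t k * cos (real k * \<theta>))"
  by (rule summable_comparison_test'[OF summable_weight[OF t]])
     (auto simp: abs_mult weight_nonneg intro!: mult_left_le)

lemma damping_sums: "(\<lambda>k. weight t k * (1 - cos (real k * \<theta>))) sums damping t \<theta>"
proof -
  have "summable (\<lambda>k. weight t k * (1 - cos (real k * \<theta>)))"
    using summable_diff[OF summable_weight[OF t] summable_weight_cos[of \<theta>]] by (simp add: algebra_simps)
  then show ?thesis unfolding damping_def by (rule summable_sums)
qed

lemma cumulant_sums: "(\<lambda>k. real k ^ j * weight t k) sums cumulant j t"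
  unfolding cumulant_def using summable_power_weight[OF t] by (rule summable_sums)

lemma damping_eq: "damping t \<theta> = cumulant 0 t - Re (eval_fps log_gf (complex_of_real (exp (- t)) * cis \<theta>))"
proof -
  have "(\<lambda>k. Re (weight t k * cis (real k * \<theta>))) sums Re (eval_fps log_gf (complex_of_real (exp (- t)) * cis \<theta>))"
    by (rule sums_Re[OF sums_log_gf[OF t]])
  from sums_diff[OF cumulant_sums[of 0] this]
  have "(\<lambda>k. weight t k * (1 - cos (real k * \<theta>))) sums
      (cumulant 0 t - Re (eval_fps log_gf (complex_of_real (exp (- t)) * cis \<theta>)))"
    by (simp add: algebra_simps)
  with damping_sums show ?thesis by (rule sums_unique2)
qed

lemma phase_sums: "(\<lambda>k. weight t k * (sin (real k * \<theta>) - real k * \<theta>)) sums phase t \<theta>"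
  and phase_eq: "phase t \<theta> = Im (eval_fps log_gf (complex_of_real (exp (- t)) * cis \<theta>)) - cumulant 1 t * \<theta>"
proof -
  have "(\<lambda>k. Im (weight t k * cis (real k * \<theta>))) sums Im (eval_fps log_gf (complex_of_real (exp (- t)) * cis \<theta>))"
    by (rule sums_Im[OF sums_log_gf[OF t]])
  from sums_diff[OF this sums_mult2[OF cumulant_sums[of 1], of \<theta>]]
  have *: "(\<lambda>k. weight t k * (sin (real k * \<theta>) - real k * \<theta>)) sums
      (Im (eval_fps log_gf (complex_of_real (exp (- t)) * cis \<theta>)) - cumulant 1 t * \<theta>)"
    by (simp add: algebra_simps)
  then show 1: "(\<lambda>k. weight t k * (sin (real k * \<theta>) - real k * \<theta>)) sums phase t \<theta>"
    unfolding phase_def by (simp add: sums_iff)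
  from 1 * show "phase t \<theta> = Im (eval_fps log_gf (complex_of_real (exp (- t)) * cis \<theta>)) - cumulant 1 t * \<theta>"
    by (rule sums_unique2)
qed

lemma continuous_on_log_gf_circle:
  "continuous_on A (\<lambda>\<theta>. eval_fps log_gf (complex_of_real (exp (- t)) * cis \<theta>))"
  by (rule continuous_on_compose2[OF holomorphic_on_imp_continuous_on[OF holomorphic_log_gf]])
     (use t in \<open>auto intro!: continuous_intros simp: norm_mult\<close>)

lemma continuous_on_damping [continuous_intros]: "continuous_on A (damping t)"
  unfolding damping_eq by (intro continuous_intros continuous_on_log_gf_circle)

lemma continuous_on_phase [continuous_intros]: "continuous_on A (phase t)"
  unfolding phase_eq by (intro continuous_intros continuous_on_log_gf_circle)

text \<open>Real part of Cauchy's formula with \<open>exp (cumulant 0 t)\<close> factored out. Later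
  \<open>j\<close> is -1, 0 or 1, so that three consecutive coefficients come from one circle and
  their integrands differ only in the term \<open>j * \<theta>\<close>.\<close>

lemma overp_integral_real:
  assumes "real m = cumulant 1 t + j"
  shows "((\<lambda>\<theta>. exp (- damping t \<theta>) * cos (phase t \<theta> - j * \<theta>)) has_integral
           2 * pi * (exp (- t * real m - cumulant 0 t) * real (overp m))) {- pi..pi}"
proof -
  let ?g = "\<lambda>\<theta>. eval_fps log_gf (complex_of_real (exp (- t)) * cis \<theta>)"
  have "((\<lambda>\<theta>. Re (exp (?g \<theta>) * cis (- real m * \<theta>))) has_integral 2 * pi * exp (- t * real m) * real (overp m)) {- pi..pi}"
    using has_integral_Re[OF overp_integral[OF t, of m]] by (simp only: Re_complex_of_real)
  from has_integral_mult_right[OF this, of "exp (- cumulant 0 t)"]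
  have "((\<lambda>\<theta>. exp (- cumulant 0 t) * Re (exp (?g \<theta>) * cis (- real m * \<theta>))) has_integral
      2 * pi * (exp (- t * real m - cumulant 0 t) * real (overp m))) {- pi..pi}"
    by (simp add: exp_diff exp_minus field_simps)
  moreover have "exp (- cumulant 0 t) * Re (exp (?g \<theta>) * cis (- real m * \<theta>))
      = exp (- damping t \<theta>) * cos (phase t \<theta> - j * \<theta>)" for \<theta>
  proof -
    have "exp (?g \<theta>) * cis (- real m * \<theta>) = of_real (exp (Re (?g \<theta>))) * cis (Im (?g \<theta>) - real m * \<theta>)"
      unfolding exp_eq_polar[of "?g \<theta>"] by (simp add: cis_mult)
    then have "Re (exp (?g \<theta>) * cis (- real m * \<theta>)) = exp (Re (?g \<theta>)) * cos (Im (?g \<theta>) - real m * \<theta>)"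
      by simp
    moreover have "Im (?g \<theta>) - real m * \<theta> = phase t \<theta> - j * \<theta>"
      unfolding assms phase_eq by (simp add: algebra_simps)
    moreover have "exp (- cumulant 0 t) * exp (Re (?g \<theta>)) = exp (- damping t \<theta>)"
      unfolding damping_eq by (simp flip: exp_add)
    ultimately show ?thesis by (simp add: mult.assoc[symmetric])
  qed
  ultimately show ?thesis by simp
qed

lemma damping_le: "damping t \<theta> \<le> cumulant 2 t * \<theta>\<^sup>2 / 2"
proof -
  have "weight t k * (1 - cos (real k * \<theta>)) \<le> real k ^ 2 * weight t k * (\<theta>\<^sup>2 / 2)" for k
    using mult_left_mono[OF one_minus_cos_le[of "real k * \<theta>"] weight_nonneg[of t k]]
    by (simp add: power_mult_distrib mult_ac)
  from sums_le[OF this damping_sums sums_mult2[OF cumulant_sums]]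
  show ?thesis by simp
qed

lemma damping_ge: "damping t \<theta> \<ge> cumulant 2 t * \<theta>\<^sup>2 / 2 - cumulant 4 t * \<theta> ^ 4 / 24"
proof -
  have "real k ^ 2 * weight t k * (\<theta>\<^sup>2 / 2) - real k ^ 4 * weight t k * (\<theta> ^ 4 / 24)
      \<le> weight t k * (1 - cos (real k * \<theta>))" for k
    using mult_left_mono[OF one_minus_cos_ge[of "real k * \<theta>"] weight_nonneg[of t k]]
    by (simp add: power_mult_distrib algebra_simps)
  from sums_le[OF this sums_diff[OF sums_mult2[OF cumulant_sums] sums_mult2[OF cumulant_sums]] damping_sums]
  show ?thesis by simp
qed

lemma phase_abs_le: "\<bar>phase t \<theta>\<bar> \<le> cumulant 3 t * \<bar>\<theta>\<bar> ^ 3 / 6"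
proof -
  have sin_bound: "\<bar>sin x - x\<bar> \<le> \<bar>x\<bar> ^ 3 / 6" for x :: real
    using Maclaurin_sin_bound[of x 3] by (simp add: eval_nat_numeral sin_coeff_def)
  have pt: "\<bar>weight t k * (sin (real k * \<theta>) - real k * \<theta>)\<bar> \<le> real k ^ 3 * weight t k * (\<bar>\<theta>\<bar> ^ 3 / 6)" for k
    using mult_left_mono[OF sin_bound[of "real k * \<theta>"] weight_nonneg[of t k]]
    by (simp add: abs_mult weight_nonneg power_mult_distrib mult_ac)
  have "phase t \<theta> \<le> cumulant 3 t * (\<bar>\<theta>\<bar> ^ 3 / 6)"
    by (rule sums_le[OF _ phase_sums sums_mult2[OF cumulant_sums]]) (use pt abs_le_D1 in blast)
  moreover have "- phase t \<theta> \<le> cumulant 3 t * (\<bar>\<theta>\<bar> ^ 3 / 6)"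
    by (rule sums_le[OF _ sums_minus[OF phase_sums] sums_mult2[OF cumulant_sums]]) (use pt abs_le_D2 in blast)
  ultimately show ?thesis by simp
qed

lemma two_power_le_weight: "k > 0 \<Longrightarrow> 2 * exp (- t) ^ k \<le> weight t k"
  using log_coeff_ge_2[of k] exp_of_nat2_mult[of "- t" k] by (simp add: weight_def)

text \<open>Bounding every \<^const>\<open>log_coeff\<close> from below by 2 leaves a geometric series.\<close>
lemma damping_ge_geometric:
  fixes \<theta> :: real
  defines "q \<equiv> exp (- t)" and "u \<equiv> 1 - cos \<theta>"
  shows "damping t \<theta> \<ge> 2 * (q * (1 + q) * u / ((1 - q) * ((1 - q)\<^sup>2 + 2 * q * u)))"
proof -
  have q: "0 < q" "q < 1" using t by (auto simp: q_def)
  have u: "0 \<le> u" by (simp add: u_def)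
  have pos: "(1 - q)\<^sup>2 + 2 * q * u > 0" using q u by (intro add_pos_nonneg) auto
  define z where "z = complex_of_real q * cis \<theta>"
  have "norm z < 1" using q by (simp add: z_def norm_mult)
  have "(\<lambda>k. Re (z ^ k)) sums Re (1 / (1 - z))"
    by (rule sums_Re[OF geometric_sums[OF \<open>norm z < 1\<close>]])
  moreover have "Re (z ^ k) = q ^ k * cos (real k * \<theta>)" for k
    unfolding z_def power_mult_distrib Complex.DeMoivre by (simp flip: of_real_power)
  moreover have "Re (1 / (1 - z)) = (1 - q * cos \<theta>) / ((1 - q)\<^sup>2 + 2 * q * u)"
  proof -
    have "(1 - q * cos \<theta>)\<^sup>2 + (q * sin \<theta>)\<^sup>2 = 1 - 2 * q * cos \<theta> + q\<^sup>2 * ((sin \<theta>)\<^sup>2 + (cos \<theta>)\<^sup>2)"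
      unfolding power2_eq_square by (simp only: algebra_simps mult_1_left mult_2)
    also have "\<dots> = (1 - q)\<^sup>2 + 2 * q * u"
      by (simp add: u_def power2_eq_square algebra_simps)
    finally have "(1 - q * cos \<theta>)\<^sup>2 + (q * sin \<theta>)\<^sup>2 = (1 - q)\<^sup>2 + 2 * q * u" .
    then show ?thesis by (simp add: z_def Re_divide)
  qed
  ultimately have "(\<lambda>k. q ^ k * cos (real k * \<theta>)) sums ((1 - q * cos \<theta>) / ((1 - q)\<^sup>2 + 2 * q * u))" by simp
  moreover have "(\<lambda>k. q ^ k) sums (1 / (1 - q))" using q by (intro geometric_sums) auto
  ultimately have "(\<lambda>k. q ^ k - q ^ k * cos (real k * \<theta>)) sums
      (1 / (1 - q) - (1 - q * cos \<theta>) / ((1 - q)\<^sup>2 + 2 * q * u))" by (intro sums_diff)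
  moreover have "1 / (1 - q) - (1 - q * cos \<theta>) / ((1 - q)\<^sup>2 + 2 * q * u)
      = q * (1 + q) * u / ((1 - q) * ((1 - q)\<^sup>2 + 2 * q * u))"
  proof -
    have "cos \<theta> = 1 - u" by (simp add: u_def)
    then show ?thesis using q pos
      by (simp add: diff_frac_eq) (simp add: power2_eq_square algebra_simps)
  qed
  ultimately have "(\<lambda>k. 2 * (q ^ k - q ^ k * cos (real k * \<theta>))) sums
      (2 * (q * (1 + q) * u / ((1 - q) * ((1 - q)\<^sup>2 + 2 * q * u))))" by (intro sums_mult) simp
  then show ?thesis
  proof (rule sums_le[OF _ _ damping_sums, rotated])
    fix k
    show "2 * (q ^ k - q ^ k * cos (real k * \<theta>)) \<le> weight t k * (1 - cos (real k * \<theta>))"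
    proof (cases "k = 0")
      case False
      have "2 * q ^ k \<le> weight t k"
        using two_power_le_weight[of k] False by (simp add: q_def)
      from mult_right_mono[OF this, of "1 - cos (real k * \<theta>)"] show ?thesis by (simp add: algebra_simps)
    qed simp
  qed
qed

context
  assumes t_le: "t \<le> 1 / 2"
begin

lemma exp_neg_bounds: "1 / 2 \<le> exp (- t)" "exp (- t) < 1" "1 - exp (- t) \<le> t"
  using exp_ge_add_one_self[of "- t"] t t_le by auto

text \<open>With all coefficients bounded below by 2 the sum is at least
  \<open>2 * q / (1 - q)\<close> for \<open>q = exp (- t)\<close>, where
  \<open>q \<ge> 1 / 2\<close> and \<open>1 - q \<le> t\<close>. The bound for
  \<open>cumulant 1 t\<close> uses the derivative of the geometric series in the same way.\<close>

lemma cumulant_0_ge: "cumulant 0 t \<ge> 1 / t"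
proof -
  let ?q = "exp (- t)"
  have "(\<lambda>k. 2 * ?q * ?q ^ k) sums (2 * ?q * (1 / (1 - ?q)))"
    using t by (intro sums_mult geometric_sums) auto
  moreover have "(\<lambda>k. real (Suc k) ^ 0 * weight t (Suc k)) sums (cumulant 0 t)"
    using sums_Suc_iff[of "\<lambda>k. real k ^ 0 * weight t k" "cumulant 0 t"] cumulant_sums[of 0]
    by (simp add: weight_def)
  ultimately have "2 * ?q * (1 / (1 - ?q)) \<le> cumulant 0 t"
  proof (rule sums_le[rotated])
    show "2 * ?q * ?q ^ k \<le> real (Suc k) ^ 0 * weight t (Suc k)" for k
      using two_power_le_weight[of "Suc k"] by simp
  qed
  moreover have "1 * (1 / t) \<le> 2 * ?q * (1 / (1 - ?q))"
    using exp_neg_bounds t by (intro mult_mono divide_left_mono) auto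
  ultimately show ?thesis by simp
qed

lemma cumulant_1_ge: "cumulant 1 t \<ge> 1 / t\<^sup>2"
proof -
  let ?q = "exp (- t)"
  have s1: "(\<lambda>k. 2 * ?q * (of_nat (Suc k) * ?q ^ k)) sums (2 * ?q * (1 / (1 - ?q)\<^sup>2))"
    using t by (intro sums_mult geometric_deriv_sums) auto
  have s2: "(\<lambda>k. real (Suc k) ^ 1 * weight t (Suc k)) sums (cumulant 1 t)"
    using sums_Suc_iff[of "\<lambda>k. real k ^ 1 * weight t k" "cumulant 1 t"] cumulant_sums[of 1]
    by simp
  have le: "2 * ?q * (of_nat (Suc k) * ?q ^ k) \<le> real (Suc k) ^ 1 * weight t (Suc k)" for k
    using mult_left_mono[OF two_power_le_weight[of "Suc k"], of "real (Suc k)"] by (simp add: mult_ac)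
  have "2 * ?q * (1 / (1 - ?q)\<^sup>2) \<le> cumulant 1 t"
    by (rule sums_le[OF _ s1 s2]) (rule le)
  moreover have "1 * (1 / t\<^sup>2) \<le> 2 * ?q * (1 / (1 - ?q)\<^sup>2)"
    using exp_neg_bounds t by (intro mult_mono divide_left_mono power_mono) auto
  ultimately show ?thesis by simp
qed

text \<open>At such angles \<open>u = 1 - cos \<theta>\<close> is at least of order
  \<open>t\<^sup>2\<close>, hence it controls \<open>(1 - q)\<^sup>2\<close> in the denominator of
  \<open>damping_ge_geometric\<close>. Then \<open>u\<close> cancels and order \<open>1 / t\<close>
  remains.\<close>

lemma damping_ge_minor:
  assumes "t / 100 \<le> \<bar>\<theta>\<bar>" "\<bar>\<theta>\<bar> \<le> pi"
  shows "damping t \<theta> \<ge> 1 / (30000 * t)"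
proof -
  define q u s where "q = exp (- t)" and "u = 1 - cos \<theta>" and "s = t / 100"
  have q: "1 / 2 \<le> q" "q < 1" "1 - q \<le> t" using exp_neg_bounds by (auto simp: q_def)
  have s: "0 < s" "s \<le> 1" using t t_le by (auto simp: s_def)
  have "cos \<theta> = cos \<bar>\<theta>\<bar>" by simp
  also have "\<dots> \<le> cos s"
    using assms s by (intro cos_monotone_0_pi_le) (auto simp: s_def)
  finally have "u \<ge> 1 - cos s" by (simp add: u_def)
  moreover have "1 - cos s \<ge> s\<^sup>2 / 2 - s ^ 4 / 24" by (rule one_minus_cos_ge)
  moreover have "s ^ 4 \<le> s\<^sup>2" using s by (intro power_decreasing) auto
  ultimately have "u \<ge> s\<^sup>2 / 4" using zero_le_power2[of s] by linarith
  then have u: "u \<ge> t\<^sup>2 / 40000" by (simp add: s_def power2_eq_square)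
  moreover have "t\<^sup>2 / 40000 > 0" using t by simp
  ultimately have u0: "u > 0" by linarith
  \<comment> \<open>The constant 40002 arises from
    \<open>(1 - q)\<^sup>2 \<le> t\<^sup>2 \<le> 40000 * u\<close> together with
    \<open>2 * q * u \<le> 2 * u\<close>.\<close>
  have "1 / (30000 * t) \<le> 2 * ((1 / 2) * (1 + 1 / 2) * u / (t * (40002 * u)))"
    using t u0 by (simp add: field_simps)
  also have "\<dots> \<le> 2 * (q * (1 + q) * u / ((1 - q) * ((1 - q)\<^sup>2 + 2 * q * u)))"
  proof (intro mult_left_mono frac_le mult_mono)
    have "(1 - q)\<^sup>2 \<le> t\<^sup>2" using q by (intro power_mono) auto
    moreover have "2 * q * u \<le> 2 * 1 * u" using q u0 by (intro mult_mono) auto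
    ultimately show "(1 - q)\<^sup>2 + 2 * q * u \<le> 40002 * u" using u by simp
    show "0 < (1 - q) * ((1 - q)\<^sup>2 + 2 * q * u)" using q u0 by (intro mult_pos_pos add_nonneg_pos) auto
  qed (use q u0 t in auto)
  also have "\<dots> \<le> damping t \<theta>" unfolding q_def u_def by (rule damping_ge_geometric)
  finally show ?thesis .
qed

end

text \<open>Cauchy-Schwarz: the weighted sum of \<open>(k - x)\<^sup>2\<close> is a quadratic in
  \<open>x\<close> that is nowhere negative; it is evaluated at its minimum.\<close>

lemma cumulant_1_square_le: "(cumulant 1 t)\<^sup>2 \<le> cumulant 0 t * cumulant 2 t"
proof -
  have "0 \<le> cumulant 2 t - 2 * x * cumulant 1 t + x\<^sup>2 * cumulant 0 t" for x
  proof -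
    have "(\<lambda>k. weight t k * (real k - x)\<^sup>2) sums (cumulant 2 t - 2 * x * cumulant 1 t + x\<^sup>2 * cumulant 0 t)"
      using sums_add[OF sums_diff[OF cumulant_sums[of 2] sums_mult[OF cumulant_sums[of 1], of "2 * x"]]
         sums_mult[OF cumulant_sums[of 0], of "x\<^sup>2"]]
      by (simp add: power2_eq_square algebra_simps)
    from sums_le[OF _ sums_zero this] show ?thesis by (auto simp: weight_nonneg)
  qed
  note quad = this
  show ?thesis
  proof (cases "cumulant 0 t = 0")
    case True
    have "cumulant 1 t = 0"
    proof (rule ccontr)
      assume "cumulant 1 t \<noteq> 0"
      \<comment> \<open>When \<open>cumulant 0 t = 0\<close> the quadratic is linear, and this
        \<open>x\<close> would give it the value -1.\<close>
      with quad[of "(cumulant 2 t + 1) / (2 * cumulant 1 t)"] True show False by simp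
    qed
    then show ?thesis by (simp add: True)
  next
    case False
    then have "cumulant 0 t > 0" using cumulant_nonneg[OF t, of 0] by simp
    then show ?thesis using quad[of "cumulant 1 t / cumulant 0 t"]
      by (simp add: power2_eq_square divide_simps algebra_simps)
  qed
qed

end

section \<open>Gaussian approximation\<close>

lemma gaussian_moment_has_integral:
  fixes a :: real assumes "a > 0"
  shows "((\<lambda>x. exp (- a * x\<^sup>2 / 2) * x ^ (2 * k)) has_integral
           sqrt (2 * pi / a) * (fact (2 * k) / ((2 * a) ^ k * fact k))) UNIV"
proof -
  define \<sigma> where "\<sigma> = 1 / sqrt a"
  have \<sigma>: "\<sigma> > 0" "\<sigma>\<^sup>2 = 1 / a" using assms by (auto simp: \<sigma>_def power_divide)
  have "has_bochner_integral lborel (\<lambda>x. normal_density 0 \<sigma> x * (x - 0) ^ (2 * k)) (fact (2 * k) / ((2 / \<sigma>\<^sup>2) ^ k * fact k))"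
    by (rule normal_moment_even[OF \<sigma>(1)])
  then have "((\<lambda>x. normal_density 0 \<sigma> x * x ^ (2 * k)) has_integral (fact (2 * k) / ((2 * a) ^ k * fact k))) UNIV"
    using has_integral_integral_lborel[of "\<lambda>x. normal_density 0 \<sigma> x * x ^ (2 * k)"]
    by (simp add: has_bochner_integral_iff \<sigma>(2))
  from has_integral_mult_right[OF this, of "sqrt (2 * pi / a)"]
  have "((\<lambda>x. sqrt (2 * pi / a) * (normal_density 0 \<sigma> x * x ^ (2 * k))) has_integral
      sqrt (2 * pi / a) * (fact (2 * k) / ((2 * a) ^ k * fact k))) UNIV" .
  moreover have "sqrt (2 * pi / a) * (normal_density 0 \<sigma> x * x ^ (2 * k)) = exp (- a * x\<^sup>2 / 2) * x ^ (2 * k)" for x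
    using assms by (simp add: normal_density_def \<sigma>(2) mult.commute)
  ultimately show ?thesis by simp
qed

lemma gaussian_moment_le:
  fixes a :: real assumes "a > 0"
  shows "integral {- pi..pi} (\<lambda>x. exp (- a * x\<^sup>2 / 2) * x ^ (2 * k))
           \<le> sqrt (2 * pi / a) * (fact (2 * k) / ((2 * a) ^ k * fact k))"
proof (rule has_integral_subset_le[OF _ integrable_integral gaussian_moment_has_integral[OF assms]])
  show "(\<lambda>x. exp (- a * x\<^sup>2 / 2) * x ^ (2 * k)) integrable_on {- pi..pi}"
    by (intro integrable_continuous_interval continuous_intros) auto
qed auto

text \<open>Outside the interval \<open>x\<^sup>2 / pi\<^sup>2 \<ge> 1\<close>, so the Gaussian
  times \<open>1 - x\<^sup>2 / pi\<^sup>2\<close> lies below the truncated Gaussian on the whole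
  line. Its integral is a difference of the moments of order 0 and 2.\<close>

lemma gaussian_integral_ge:
  fixes a :: real assumes "a > 0"
  shows "integral {- pi..pi} (\<lambda>x. exp (- a * x\<^sup>2 / 2)) \<ge> sqrt (2 * pi / a) * (1 - 1 / (pi\<^sup>2 * a))"
proof -
  let ?e = "\<lambda>x. exp (- a * x\<^sup>2 / 2)"
  have 1: "((\<lambda>x. ?e x * x ^ (2 * 0) - ?e x * x ^ (2 * 1) / pi\<^sup>2) has_integral
      (sqrt (2 * pi / a) * (fact (2 * 0) / ((2 * a) ^ 0 * fact 0)) -
       sqrt (2 * pi / a) * (fact (2 * 1) / ((2 * a) ^ 1 * fact 1)) / pi\<^sup>2)) UNIV"
    by (intro has_integral_diff has_integral_divide gaussian_moment_has_integral assms)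
  have "?e integrable_on {- pi..pi}"
    by (intro integrable_continuous_interval continuous_intros) auto
  then have 2: "((\<lambda>x. if x \<in> {- pi..pi} then ?e x else 0) has_integral integral {- pi..pi} ?e) UNIV"
    by (simp only: has_integral_restrict_UNIV integrable_integral)
  have "?e x * x ^ (2 * 0) - ?e x * x ^ (2 * 1) / pi\<^sup>2 \<le> (if x \<in> {- pi..pi} then ?e x else 0)" for x
  proof (cases "x \<in> {- pi..pi}")
    case False
    then have "pi\<^sup>2 \<le> x\<^sup>2" by (simp flip: abs_le_square_iff) linarith
    then have "?e x * 1 \<le> ?e x * (x\<^sup>2 / pi\<^sup>2)" by (intro mult_left_mono) auto
    then show ?thesis using False by auto
  qed simp
  from has_integral_le[OF 1 2 this] show ?thesis
    using assms by (simp add: field_simps power2_eq_square)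
qed

section \<open>Estimates of the integrals around the saddle point\<close>

definition local_integral :: "real \<Rightarrow> real \<Rightarrow> real" where
  "local_integral t j = integral {- pi..pi} (\<lambda>\<theta>. exp (- damping t \<theta>) * cos (phase t \<theta> - j * \<theta>))"

context
  fixes t :: real assumes t: "0 < t" "t \<le> 1 / 10 ^ 80"
begin

lemma t_le_half: "t \<le> 1 / 2"
  by (rule order_trans[OF t(2)]) simp

text \<open>Cauchy-Schwarz converts the lower bound for \<open>cumulant 1 t\<close> and the upper
  bound for \<open>cumulant 0 t\<close> into a lower bound here.\<close>

lemma cumulant_2_ge: "cumulant 2 t \<ge> 1 / (8 * t ^ 3)"
proof -
  have k0: "cumulant 0 t \<le> 8 / t" using cumulant_le[OF t(1), of 0] by simp
  have "(1 / t\<^sup>2)\<^sup>2 \<le> (cumulant 1 t)\<^sup>2"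
    using cumulant_1_ge[OF t(1) t_le_half] t by (intro power_mono) auto
  also have "\<dots> \<le> cumulant 0 t * cumulant 2 t" by (rule cumulant_1_square_le[OF t(1)])
  also have "\<dots> \<le> 8 / t * cumulant 2 t"
    using k0 cumulant_nonneg[OF t(1)] by (intro mult_right_mono) auto
  finally show ?thesis using t by (simp add: field_simps power2_eq_square power3_eq_cube)
qed

lemma cumulant_2_le: "cumulant 2 t \<le> 64 / t ^ 3"
  using cumulant_le[OF t(1), of 2] by (simp add: power2_eq_square power3_eq_cube)

lemma cumulant_3_le: "cumulant 3 t \<le> 384 / t ^ 4"
  using cumulant_le[OF t(1), of 3] by (simp add: fact_numeral power_divide power_Suc eval_nat_numeral)

lemma cumulant_4_le: "cumulant 4 t \<le> 3072 / t ^ 5"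
  using cumulant_le[OF t(1), of 4] by (simp add: fact_numeral power_divide power_Suc eval_nat_numeral)

lemma cumulant_2_pos: "cumulant 2 t > 0"
  using cumulant_2_ge t by (smt (verit) zero_less_divide_1_iff zero_less_power mult_pos_pos)

text \<open>For angles up to \<open>t / 100\<close> the quartic Taylor term takes away at most a
  quarter of the quadratic one, which leaves a Gaussian with parameter
  \<open>3 / 4 * cumulant 2 t\<close>. Elsewhere \<open>damping_ge_minor\<close> applies. Adding
  both bounds gives one estimate for all angles.\<close>

lemma exp_damping_le:
  assumes "\<theta> \<in> {- pi..pi}"
  shows "exp (- damping t \<theta>) \<le> exp (- (3 / 4 * cumulant 2 t) * \<theta>\<^sup>2 / 2) + exp (- 1 / (30000 * t))"
proof (cases "\<bar>\<theta>\<bar> \<le> t / 100")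
  case True
  have "\<theta>\<^sup>2 \<le> (t / 100)\<^sup>2" using True power_mono[of "\<bar>\<theta>\<bar>" "t / 100" 2] by simp
  then have "cumulant 4 t * \<theta>\<^sup>2 \<le> 3072 / t ^ 5 * (t / 100)\<^sup>2"
    using cumulant_4_le t by (intro mult_mono) auto
  also have "\<dots> = 3072 / 10000 / t ^ 3"
    using t by (simp add: power2_eq_square eval_nat_numeral)
  also have "\<dots> \<le> 3 * (1 / (8 * t ^ 3))" using t by (simp add: field_simps)
  also have "\<dots> \<le> 3 * cumulant 2 t" using cumulant_2_ge by simp
  finally have "cumulant 4 t * \<theta>\<^sup>2 * \<theta>\<^sup>2 \<le> 3 * cumulant 2 t * \<theta>\<^sup>2" by (rule mult_right_mono) simp
  then have "cumulant 4 t * \<theta> ^ 4 \<le> 3 * cumulant 2 t * \<theta>\<^sup>2"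
    by (simp add: power2_eq_square eval_nat_numeral mult_ac)
  with damping_ge[OF t(1), of \<theta>] have "damping t \<theta> \<ge> (3 / 4 * cumulant 2 t) * \<theta>\<^sup>2 / 2" by simp
  then have "exp (- damping t \<theta>) \<le> exp (- (3 / 4 * cumulant 2 t) * \<theta>\<^sup>2 / 2)" by simp
  then show ?thesis by (smt (verit) exp_gt_zero)
next
  case False
  then have "damping t \<theta> \<ge> 1 / (30000 * t)"
    using assms by (intro damping_ge_minor[OF t(1) t_le_half]) auto
  then have "exp (- damping t \<theta>) \<le> exp (- 1 / (30000 * t))" by simp
  then show ?thesis by (smt (verit) exp_gt_zero)
qed

text \<open>The exponential is compared with the 14th term of its series; the one spare factor
  \<open>t\<close> absorbs \<open>fact 14 * 30000 ^ 14\<close>, which is below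
  \<open>10 ^ 74\<close>.\<close>

lemma minor_arc_le: "exp (- 1 / (30000 * t)) \<le> t ^ 13"
proof -
  define x where "x = 1 / (30000 * t)"
  have x: "x > 0" using t by (simp add: x_def)
  have "x ^ 14 \<le> fact 14 * exp x" using x by (intro power_le_fact_exp) auto
  then have "exp (- x) \<le> fact 14 / x ^ 14" using x by (simp add: exp_minus field_simps)
  also have "\<dots> = fact 14 * 30000 ^ 14 * t ^ Suc 13"
    using t by (simp add: x_def power_divide power_mult_distrib)
  also have "\<dots> = fact 14 * 30000 ^ 14 * t * t ^ 13" by (simp only: power_Suc mult.assoc)
  also have "\<dots> \<le> fact 14 * 30000 ^ 14 * (1 / 10 ^ 80) * t ^ 13"
    using t by (intro mult_right_mono mult_left_mono) auto
  also have "\<dots> \<le> 1 * t ^ 13"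
    using t by (intro mult_right_mono) (auto simp: fact_numeral)
  finally show ?thesis by (simp add: x_def)
qed

text \<open>This is the integral of \<open>exp (- cumulant 2 t * \<theta>\<^sup>2 / 2)\<close> over
  the real line, the unit in which the local integrals are measured.\<close>

abbreviation "mass \<equiv> sqrt (2 * pi / cumulant 2 t)"

lemma mass_ge: "mass \<ge> t\<^sup>2"
proof (rule real_le_rsqrt)
  have "(t\<^sup>2)\<^sup>2 = t ^ 3 * t" by (simp add: eval_nat_numeral)
  also have "\<dots> \<le> t ^ 3 * (1 / 64)" using t by (intro mult_left_mono order_trans[OF t(2)]) auto
  also have "\<dots> = 1 / (64 / t ^ 3)" by simp
  also have "\<dots> \<le> 1 / cumulant 2 t"
    using cumulant_2_le cumulant_2_pos t by (intro divide_left_mono) auto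
  also have "\<dots> \<le> 2 * pi / cumulant 2 t"
    using cumulant_2_pos pi_gt3 by (intro divide_right_mono) auto
  finally show "(t\<^sup>2)\<^sup>2 \<le> 2 * pi / cumulant 2 t" .
qed

text \<open>The factor \<open>231 / 200\<close> bounds \<open>sqrt (4 / 3)\<close>; it and
  \<open>(4 / 3) ^ k\<close> are the price for the weakened Gaussian parameter
  \<open>3 / 4 * cumulant 2 t\<close>. The summand \<open>1 / 100\<close> accounts for the angles
  away from the saddle.\<close>

lemma damped_moment_le:
  assumes "k \<le> 3"
  shows "integral {- pi..pi} (\<lambda>\<theta>. exp (- damping t \<theta>) * \<theta> ^ (2 * k))
     \<le> mass / cumulant 2 t ^ k * (231 / 200 * (4 / 3) ^ k * (fact (2 * k) / (2 ^ k * fact k)) + 1 / 100)"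
proof -
  let ?a = "3 / 4 * cumulant 2 t" and ?E = "exp (- 1 / (30000 * t))" and ?s = "cumulant 2 t"
  have a: "?a > 0" using cumulant_2_pos by simp
  have "integral {- pi..pi} (\<lambda>\<theta>. exp (- damping t \<theta>) * \<theta> ^ (2 * k))
      \<le> integral {- pi..pi} (\<lambda>\<theta>. exp (- ?a * \<theta>\<^sup>2 / 2) * \<theta> ^ (2 * k) + ?E * pi ^ (2 * k))"
  proof (rule integral_le)
    fix \<theta> assume \<theta>: "\<theta> \<in> {- pi..pi}"
    have "\<theta> ^ (2 * k) \<le> pi ^ (2 * k)"
      using \<theta> power_mono[of "\<bar>\<theta>\<bar>" pi "2 * k"] by (simp add: power_even_abs abs_le_iff)
    have "exp (- damping t \<theta>) * \<theta> ^ (2 * k) \<le> (exp (- ?a * \<theta>\<^sup>2 / 2) + ?E) * \<theta> ^ (2 * k)"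
      using exp_damping_le[OF \<theta>] by (intro mult_right_mono) auto
    also have "\<dots> \<le> exp (- ?a * \<theta>\<^sup>2 / 2) * \<theta> ^ (2 * k) + ?E * pi ^ (2 * k)"
      using \<open>\<theta> ^ (2 * k) \<le> pi ^ (2 * k)\<close> by (simp add: distrib_right)
    finally show "exp (- damping t \<theta>) * \<theta> ^ (2 * k) \<le> exp (- ?a * \<theta>\<^sup>2 / 2) * \<theta> ^ (2 * k) + ?E * pi ^ (2 * k)" .
  qed (intro integrable_continuous_interval continuous_intros t; simp)+
  also have "\<dots> = integral {- pi..pi} (\<lambda>\<theta>. exp (- ?a * \<theta>\<^sup>2 / 2) * \<theta> ^ (2 * k)) + integral {- pi..pi} (\<lambda>\<theta>. ?E * pi ^ (2 * k))"
    by (intro Henstock_Kurzweil_Integration.integral_add integrable_continuous_interval continuous_intros) auto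
  also have "integral {- pi..pi} (\<lambda>\<theta>. ?E * pi ^ (2 * k)) = 2 * pi ^ Suc (2 * k) * ?E"
    by simp
  also have "\<dots> \<le> mass / ?s ^ k * (1 / 100)"
  proof -
    \<comment> \<open>For \<open>k \<le> 3\<close> the target \<open>mass / cumulant 2 t ^ k\<close>
      is at least of order \<open>t ^ 11\<close>, so \<open>t ^ 13\<close> leaves a factor
      \<open>t\<^sup>2\<close> for the constants.\<close>
    have "2 * pi ^ Suc (2 * k) * ?E \<le> 2 * 4 ^ 7 * t ^ 13"
    proof (intro mult_mono minor_arc_le)
      have "pi ^ Suc (2 * k) \<le> 4 ^ Suc (2 * k)" using pi_less_4 by (intro power_mono) auto
      also have "\<dots> \<le> 4 ^ 7" using assms by (intro power_increasing) auto
      finally show "pi ^ Suc (2 * k) \<le> 4 ^ 7" .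
    qed auto
    also have "\<dots> = 2 * 4 ^ 7 * 100 * 64 ^ 3 * t\<^sup>2 * (t\<^sup>2 / (64 / t ^ 3) ^ 3 * (1 / 100))"
      using t by (simp add: power_divide eval_nat_numeral)
    also have "\<dots> \<le> 1 * (t\<^sup>2 / (64 / t ^ 3) ^ 3 * (1 / 100))"
    proof (rule mult_right_mono)
      have "t\<^sup>2 \<le> t * 1" unfolding power2_eq_square using t t_le_half by (intro mult_left_mono) auto
      also have "\<dots> \<le> 1 / 10 ^ 80" using t by simp
      finally show "2 * 4 ^ 7 * 100 * 64 ^ 3 * t\<^sup>2 \<le> 1" by simp
    qed (use t in auto)
    also have "\<dots> \<le> 1 * (mass / ?s ^ k * (1 / 100))"
    proof (intro mult_mono frac_le mass_ge)
      have "1 \<le> 64 / t ^ 3" using t t_le_half power_le_one[of t 3] by (simp add: field_simps)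
      have "?s ^ k \<le> (64 / t ^ 3) ^ k" using cumulant_2_le cumulant_2_pos by (intro power_mono) auto
      also have "\<dots> \<le> (64 / t ^ 3) ^ 3" using assms \<open>1 \<le> 64 / t ^ 3\<close> by (intro power_increasing) auto
      finally show "?s ^ k \<le> (64 / t ^ 3) ^ 3" .
    qed (use t cumulant_2_pos in auto)
    finally show ?thesis by simp
  qed
  also have "integral {- pi..pi} (\<lambda>\<theta>. exp (- ?a * \<theta>\<^sup>2 / 2) * \<theta> ^ (2 * k))
      \<le> sqrt (2 * pi / ?a) * (fact (2 * k) / ((2 * ?a) ^ k * fact k))"
    by (rule gaussian_moment_le[OF a])
  also have "sqrt (2 * pi / ?a) = sqrt (4 / 3) * mass"
    by (simp add: real_sqrt_mult[symmetric])
  also have "sqrt (4 / 3) * mass * (fact (2 * k) / ((2 * ?a) ^ k * fact k))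
      \<le> 231 / 200 * mass * (fact (2 * k) / ((2 * ?a) ^ k * fact k))"
  proof (intro mult_right_mono)
    show "sqrt (4 / 3) \<le> 231 / 200" by (rule real_le_lsqrt) (auto simp: power2_eq_square)
  qed (use cumulant_2_pos in auto)
  also have "231 / 200 * mass * (fact (2 * k) / ((2 * ?a) ^ k * fact k))
      = mass / ?s ^ k * (231 / 200 * (4 / 3) ^ k * (fact (2 * k) / (2 ^ k * fact k)))"
  proof -
    have "(4 :: real) ^ k = 2 ^ k * 2 ^ k" by (simp flip: power_mult_distrib)
    then show ?thesis by (simp add: power_mult_distrib power_divide field_simps)
  qed
  finally show ?thesis by (simp add: distrib_left)
qed

lemma local_integral_has_integral:
  "((\<lambda>\<theta>. exp (- damping t \<theta>) * cos (phase t \<theta> - j * \<theta>)) has_integral local_integral t j) {- pi..pi}"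
  unfolding local_integral_def
  by (intro integrable_integral integrable_continuous_interval continuous_intros t(1))

lemma damped_moment_integrable: "(\<lambda>\<theta>. exp (- damping t \<theta>) * \<theta> ^ k) integrable_on {- pi..pi}"
  by (intro integrable_continuous_interval continuous_intros t(1))

lemma inverse_cumulant_2_le: "1 / cumulant 2 t \<le> 8 * t ^ 3"
  using cumulant_2_ge cumulant_2_pos t by (simp add: field_simps)

lemma mass_pos: "mass > 0"
  using cumulant_2_pos by simp

lemma inverse_cumulant_2_power_le: "1 / cumulant 2 t ^ k \<le> (8 * t ^ 3) ^ k"
  using power_mono[OF inverse_cumulant_2_le, of k] cumulant_2_pos by (simp add: power_divide)

text \<open>The damping is at most its quadratic Taylor term, which gives a full Gaussian. Replacing
  the cosine of the phase by 1 costs at most a multiple of \<open>(cumulant 3 t)\<^sup>2\<close>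
  times the sixth moment, that is, order \<open>t * mass\<close>.\<close>

lemma local_integral_0_ge: "local_integral t 0 \<ge> 99 / 100 * mass"
proof -
  let ?e = "\<lambda>\<theta>. exp (- damping t \<theta>)" and ?s = "cumulant 2 t"
  have "integral {- pi..pi} (\<lambda>\<theta>. exp (- ?s * \<theta>\<^sup>2 / 2)) - (cumulant 3 t)\<^sup>2 / 72 * integral {- pi..pi} (\<lambda>\<theta>. ?e \<theta> * \<theta> ^ (2 * 3))
      = integral {- pi..pi} (\<lambda>\<theta>. exp (- ?s * \<theta>\<^sup>2 / 2) - (cumulant 3 t)\<^sup>2 / 72 * (?e \<theta> * \<theta> ^ (2 * 3)))"
    by (subst Henstock_Kurzweil_Integration.integral_diff)
       (auto intro!: integrable_continuous_interval continuous_intros t(1))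
  also have "\<dots> \<le> local_integral t 0" unfolding local_integral_def
  proof (rule integral_le)
    fix \<theta> :: real
    let ?B = "phase t \<theta>"
    have "?B\<^sup>2 \<le> (cumulant 3 t * \<bar>\<theta>\<bar> ^ 3 / 6)\<^sup>2"
      using phase_abs_le[OF t(1), of \<theta>] power_mono[of "\<bar>?B\<bar>" "cumulant 3 t * \<bar>\<theta>\<bar> ^ 3 / 6" 2] by simp
    also have "\<dots> = (cumulant 3 t)\<^sup>2 * \<theta> ^ 6 / 36"
      by (simp add: power_mult_distrib power_divide flip: power_mult)
    finally have B: "?B\<^sup>2 \<le> (cumulant 3 t)\<^sup>2 * \<theta> ^ 6 / 36" .
    have "1 - ?B\<^sup>2 / 2 \<le> cos ?B" using one_minus_cos_le[of ?B] by simp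
    then have "?e \<theta> * (1 - (cumulant 3 t)\<^sup>2 * \<theta> ^ 6 / 72) \<le> ?e \<theta> * cos ?B"
      using B by (intro mult_left_mono) auto
    moreover have "?e \<theta> * (1 - (cumulant 3 t)\<^sup>2 * \<theta> ^ 6 / 72) = ?e \<theta> - (cumulant 3 t)\<^sup>2 / 72 * (?e \<theta> * \<theta> ^ (2 * 3))"
      by (simp add: algebra_simps)
    moreover have "exp (- ?s * \<theta>\<^sup>2 / 2) \<le> ?e \<theta>" using damping_le[OF t(1), of \<theta>] by simp
    ultimately show "exp (- ?s * \<theta>\<^sup>2 / 2) - (cumulant 3 t)\<^sup>2 / 72 * (?e \<theta> * \<theta> ^ (2 * 3)) \<le> ?e \<theta> * cos (phase t \<theta> - 0 * \<theta>)"
      unfolding mult_zero_left diff_0_right by linarith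
  qed (intro integrable_continuous_interval continuous_intros t(1); simp)+
  finally have 1: "integral {- pi..pi} (\<lambda>\<theta>. exp (- ?s * \<theta>\<^sup>2 / 2)) - (cumulant 3 t)\<^sup>2 / 72 * integral {- pi..pi} (\<lambda>\<theta>. ?e \<theta> * \<theta> ^ (2 * 3))
      \<le> local_integral t 0" .
  have "mass * (1 - 1 / 1000) \<le> mass * (1 - 1 / (pi\<^sup>2 * ?s))"
  proof (rule mult_left_mono)
    have "1 / (pi\<^sup>2 * ?s) \<le> 1 / (1 * ?s)"
      using pi_gt3 cumulant_2_pos by (intro divide_left_mono mult_right_mono) (auto intro!: one_le_power)
    also have "\<dots> \<le> 8 * t ^ 3" using inverse_cumulant_2_le by simp
    also have "\<dots> \<le> 8 * t ^ 1" using t t_le_half by (intro mult_left_mono power_decreasing) auto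
    also have "\<dots> \<le> 1 / 1000" using t by simp
    finally show "1 - 1 / 1000 \<le> 1 - 1 / (pi\<^sup>2 * ?s)" by simp
  qed (use mass_pos in simp)
  also have "\<dots> \<le> integral {- pi..pi} (\<lambda>\<theta>. exp (- ?s * \<theta>\<^sup>2 / 2))"
    by (rule gaussian_integral_ge[OF cumulant_2_pos])
  finally have 2: "mass * (1 - 1 / 1000) \<le> integral {- pi..pi} (\<lambda>\<theta>. exp (- ?s * \<theta>\<^sup>2 / 2))" .
  have "(cumulant 3 t)\<^sup>2 / 72 * integral {- pi..pi} (\<lambda>\<theta>. ?e \<theta> * \<theta> ^ (2 * 3))
      \<le> (384 / t ^ 4)\<^sup>2 / 72 * (mass * (8 * t ^ 3) ^ 3 * 50)"
  proof (intro mult_mono divide_right_mono power_mono)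
    have "integral {- pi..pi} (\<lambda>\<theta>. ?e \<theta> * \<theta> ^ (2 * 3)) \<le> mass * (1 / ?s ^ 3) * (231 / 200 * (4 / 3) ^ 3 * (fact (2 * 3) / (2 ^ 3 * fact 3)) + 1 / 100)"
      using damped_moment_le[of 3] by simp
    also have "\<dots> \<le> mass * (8 * t ^ 3) ^ 3 * 50"
      using inverse_cumulant_2_power_le[of 3] mass_pos cumulant_2_pos t
      by (intro mult_mono) (auto simp: fact_numeral power_divide)
    finally show "integral {- pi..pi} (\<lambda>\<theta>. ?e \<theta> * \<theta> ^ (2 * 3)) \<le> mass * (8 * t ^ 3) ^ 3 * 50" .
    show "0 \<le> integral {- pi..pi} (\<lambda>\<theta>. ?e \<theta> * \<theta> ^ (2 * 3))"
      by (intro Henstock_Kurzweil_Integration.integral_nonneg damped_moment_integrable) simp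
  qed (use t cumulant_3_le cumulant_nonneg in auto)
  also have "\<dots> = 52428800 * t * mass" using t by (simp add: power_divide power_mult_distrib) (simp add: field_simps eval_nat_numeral)
  also have "\<dots> \<le> 1 / 1000 * mass" using t mass_pos by (intro mult_right_mono) auto
  finally have 3: "(cumulant 3 t)\<^sup>2 / 72 * integral {- pi..pi} (\<lambda>\<theta>. ?e \<theta> * \<theta> ^ (2 * 3)) \<le> 1 / 1000 * mass" .
  have "99 / 100 * m \<le> v" if "x \<le> 1 / 1000 * m" "i - x \<le> v" "m * (1 - 1 / 1000) \<le> i" "0 < m" for m x i v :: real
    using that by simp
  from this[OF 3 1 2 mass_pos] show ?thesis .
qed

text \<open>The three cosines combine to
  \<open>- 2 * cos (phase t \<theta>) * (1 - cos \<theta>)\<close>, at most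
  \<open>\<theta>\<^sup>2\<close> in absolute value. The constant is
  \<open>231 / 200 * 4 / 3 + 1 / 100\<close>; it has to stay clearly below 2, since it competes with
  \<open>2 * cumulant 0 t\<close>.\<close>

lemma local_integral_second_difference:
  "\<bar>local_integral t 1 + local_integral t (- 1) - 2 * local_integral t 0\<bar> \<le> 31 / 20 * mass / cumulant 2 t"
proof -
  let ?e = "\<lambda>\<theta>. exp (- damping t \<theta>)"
  have 1: "((\<lambda>\<theta>. ?e \<theta> * cos (phase t \<theta> - 1 * \<theta>) + ?e \<theta> * cos (phase t \<theta> - (- 1) * \<theta>) - 2 * (?e \<theta> * cos (phase t \<theta> - 0 * \<theta>)))
      has_integral (local_integral t 1 + local_integral t (- 1) - 2 * local_integral t 0)) {- pi..pi}"
    by (intro has_integral_diff has_integral_add has_integral_mult_right local_integral_has_integral)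
  have 2: "norm (?e \<theta> * cos (phase t \<theta> - 1 * \<theta>) + ?e \<theta> * cos (phase t \<theta> - (- 1) * \<theta>) - 2 * (?e \<theta> * cos (phase t \<theta> - 0 * \<theta>)))
      \<le> ?e \<theta> * \<theta> ^ (2 * 1)" for \<theta>
  proof -
    have "?e \<theta> * cos (phase t \<theta> - 1 * \<theta>) + ?e \<theta> * cos (phase t \<theta> - (- 1) * \<theta>) - 2 * (?e \<theta> * cos (phase t \<theta> - 0 * \<theta>))
        = - (?e \<theta> * (cos (phase t \<theta>) * (2 * (1 - cos \<theta>))))"
      by (simp add: cos_diff cos_add algebra_simps)
    also have "norm \<dots> = ?e \<theta> * (\<bar>cos (phase t \<theta>)\<bar> * (2 * (1 - cos \<theta>)))"
      by (simp add: abs_mult)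
    also have "\<dots> \<le> ?e \<theta> * (1 * (2 * (\<theta>\<^sup>2 / 2)))"
      using one_minus_cos_le[of \<theta>] by (intro mult_left_mono mult_mono) auto
    finally show ?thesis by simp
  qed
  have "\<bar>local_integral t 1 + local_integral t (- 1) - 2 * local_integral t 0\<bar> \<le> integral {- pi..pi} (\<lambda>\<theta>. ?e \<theta> * \<theta> ^ (2 * 1))"
    using integral_norm_bound_integral[OF has_integral_integrable[OF 1] damped_moment_integrable 2] integral_unique[OF 1] by simp
  also have "\<dots> \<le> 31 / 20 * mass / cumulant 2 t"
    using damped_moment_le[of 1] by (simp add: mult.commute)
  finally show ?thesis .
qed

text \<open>The cosines combine to \<open>2 * sin (phase t \<theta>) * sin \<theta>\<close>. As the
  phase is cubic in \<theta>, the fourth moment appears, with a gain of order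
  \<open>t\<^sup>2\<close> over \<open>mass\<close>.\<close>

lemma local_integral_first_difference:
  "\<bar>local_integral t 1 - local_integral t (- 1)\<bar> \<le> 51000 * t\<^sup>2 * mass"
proof -
  let ?e = "\<lambda>\<theta>. exp (- damping t \<theta>)"
  have 1: "((\<lambda>\<theta>. ?e \<theta> * cos (phase t \<theta> - 1 * \<theta>) - ?e \<theta> * cos (phase t \<theta> - (- 1) * \<theta>))
      has_integral (local_integral t 1 - local_integral t (- 1))) {- pi..pi}"
    by (intro has_integral_diff local_integral_has_integral)
  have 2: "norm (?e \<theta> * cos (phase t \<theta> - 1 * \<theta>) - ?e \<theta> * cos (phase t \<theta> - (- 1) * \<theta>))
      \<le> cumulant 3 t / 3 * (?e \<theta> * \<theta> ^ (2 * 2))" for \<theta>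
  proof -
    have "?e \<theta> * cos (phase t \<theta> - 1 * \<theta>) - ?e \<theta> * cos (phase t \<theta> - (- 1) * \<theta>) = ?e \<theta> * (2 * sin (phase t \<theta>) * sin \<theta>)"
      by (simp add: cos_diff cos_add algebra_simps)
    also have "norm \<dots> = ?e \<theta> * (2 * \<bar>sin (phase t \<theta>)\<bar> * \<bar>sin \<theta>\<bar>)" by (simp add: abs_mult)
    also have "\<dots> \<le> ?e \<theta> * (2 * (cumulant 3 t * \<bar>\<theta>\<bar> ^ 3 / 6) * \<bar>\<theta>\<bar>)"
      using order_trans[OF abs_sin_x_le_abs_x phase_abs_le[OF t(1), of \<theta>]] abs_sin_x_le_abs_x[of \<theta>] cumulant_nonneg[OF t(1)]
      by (intro mult_left_mono mult_mono) auto
    also have "\<dots> = cumulant 3 t / 3 * (?e \<theta> * \<bar>\<theta>\<bar> ^ 4)" by (simp add: eval_nat_numeral)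
    finally show ?thesis by (simp add: power_even_abs)
  qed
  have "\<bar>local_integral t 1 - local_integral t (- 1)\<bar> \<le> integral {- pi..pi} (\<lambda>\<theta>. cumulant 3 t / 3 * (?e \<theta> * \<theta> ^ (2 * 2)))"
    using integral_norm_bound_integral[OF has_integral_integrable[OF 1] integrable_on_mult_right[OF damped_moment_integrable] 2] integral_unique[OF 1] by simp
  also have "\<dots> = cumulant 3 t / 3 * integral {- pi..pi} (\<lambda>\<theta>. ?e \<theta> * \<theta> ^ (2 * 2))" by simp
  also have "\<dots> \<le> 384 / t ^ 4 / 3 * (mass * (8 * t ^ 3) ^ 2 * (62 / 10))"
  proof (intro mult_mono divide_right_mono cumulant_3_le)
    have "integral {- pi..pi} (\<lambda>\<theta>. ?e \<theta> * \<theta> ^ (2 * 2)) \<le> mass * (1 / cumulant 2 t ^ 2) * (231 / 200 * (4 / 3) ^ 2 * (fact (2 * 2) / (2 ^ 2 * fact 2)) + 1 / 100)"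
      using damped_moment_le[of 2] by simp
    also have "\<dots> \<le> mass * (8 * t ^ 3) ^ 2 * (62 / 10)"
      using inverse_cumulant_2_power_le[of 2] mass_pos t
      by (intro mult_mono) (auto simp: fact_numeral power_divide)
    finally show "integral {- pi..pi} (\<lambda>\<theta>. ?e \<theta> * \<theta> ^ (2 * 2)) \<le> mass * (8 * t ^ 3) ^ 2 * (62 / 10)" .
    show "0 \<le> integral {- pi..pi} (\<lambda>\<theta>. ?e \<theta> * \<theta> ^ (2 * 2))"
      by (intro Henstock_Kurzweil_Integration.integral_nonneg damped_moment_integrable) simp
  qed (use t in auto)
  also have "\<dots> = 507904 / 10 * t\<^sup>2 * mass"
    using t by (simp add: field_simps eval_nat_numeral)
  also have "\<dots> \<le> 51000 * t\<^sup>2 * mass" using mass_pos t by (intro mult_right_mono) auto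
  finally show ?thesis .
qed

end

section \<open>Logarithms of three consecutive overpartition numbers\<close>

lemma ln_overp_eq:
  assumes t: "0 < t" and m: "real m = cumulant 1 t + j" and pos: "local_integral t j > 0"
  shows "ln (real (overp m)) = ln (local_integral t j / (2 * pi)) + t * real m + cumulant 0 t"
proof -
  let ?p = "real (overp m)" and ?c = "exp (- t * real m - cumulant 0 t)"
  have "local_integral t j = 2 * pi * (?c * ?p)"
    unfolding local_integral_def by (rule integral_unique[OF overp_integral_real[OF t m]])
  then have eq: "local_integral t j / (2 * pi) = ?c * ?p" by simp
  with pos have "?c * ?p > 0" by (metis divide_pos_pos pi_gt_zero zero_less_mult_iff zero_less_numeral)
  then have "?p > 0" by (simp add: zero_less_mult_iff)
  then show ?thesis unfolding eq by (simp add: ln_mult)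
qed

text \<open>The combination annihilates the linear term \<open>t * m\<close> and doubles constants,
  so \<open>2 * cumulant 0 t\<close> survives. What remains are the logarithms of the local
  integrals.\<close>

lemma ln_overp_convexity_at_saddle:
  fixes n :: nat
  assumes t: "0 < t" "t \<le> 1 / 10 ^ 80" and n: "real n = cumulant 1 t" "n \<ge> 1"
  defines "L \<equiv> \<lambda>m. ln (real (overp m))"
  shows "(real n)\<^sup>2 * (L (n + 1) + L (n - 1) - 2 * L n) - real n * (L (n + 1) - L (n - 1)) + 2 * L n
           \<ge> 1 / (10 * t)"
proof -
  let ?s = "cumulant 2 t"
  define M where "M = sqrt (2 * pi / ?s)"
  define V where "V = local_integral t"
  \<comment> \<open>Relative deviations of the neighbouring integrals: the second difference
    controls \<open>x + y\<close>, the first difference controls \<open>x - y\<close>.\<close>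
  define x y where "x = V 1 / V 0 - 1" and "y = V (- 1) / V 0 - 1"
  have s: "?s > 0" "1 / ?s \<le> 8 * t ^ 3"
    using cumulant_2_pos[OF t] inverse_cumulant_2_le[OF t] by auto
  have M: "M > 0" "M \<ge> t\<^sup>2" using mass_pos[OF t] mass_ge[OF t] by (auto simp: M_def)
  have V0: "V 0 \<ge> 99 / 100 * M" using local_integral_0_ge[OF t] by (simp add: V_def M_def)
  have V0_pos: "V 0 > 0" using V0 M by linarith
  have ratio: "\<bar>z\<bar> / V 0 \<le> c" if "\<bar>z\<bar> \<le> 99 / 100 * c * M" "c \<ge> 0" for z c
  proof -
    have "99 / 100 * M * c \<le> V 0 * c" using V0 that by (intro mult_right_mono)
    then show ?thesis using that V0_pos by (simp add: field_simps)
  qed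
  have "x + y = (V 1 + V (- 1) - 2 * V 0) / V 0" using V0_pos by (simp add: x_def y_def field_simps)
  then have "\<bar>x + y\<bar> = \<bar>V 1 + V (- 1) - 2 * V 0\<bar> / V 0" using V0_pos by simp
  also have "\<dots> \<le> 157 / 100 * (1 / ?s)"
  proof (rule ratio)
    have "\<bar>V 1 + V (- 1) - 2 * V 0\<bar> \<le> 31 / 20 * M / ?s"
      using local_integral_second_difference[OF t] by (simp add: V_def M_def)
    also have "\<dots> \<le> 99 / 100 * (157 / 100 * (1 / ?s)) * M" using s M by (simp add: field_simps)
    finally show "\<bar>V 1 + V (- 1) - 2 * V 0\<bar> \<le> 99 / 100 * (157 / 100 * (1 / ?s)) * M" .
  qed (use s in auto)
  finally have sum: "\<bar>x + y\<bar> \<le> 157 / 100 * (1 / ?s)" .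
  have "x - y = (V 1 - V (- 1)) / V 0" using V0_pos by (simp add: x_def y_def field_simps)
  then have "\<bar>x - y\<bar> = \<bar>V 1 - V (- 1)\<bar> / V 0" using V0_pos by simp
  also have "\<dots> \<le> 52000 * t\<^sup>2"
  proof (rule ratio)
    have "\<bar>V 1 - V (- 1)\<bar> \<le> 51000 * t\<^sup>2 * M"
      using local_integral_first_difference[OF t] by (simp add: V_def M_def)
    also have "\<dots> \<le> 99 / 100 * (52000 * t\<^sup>2) * M" using M by (intro mult_right_mono) auto
    finally show "\<bar>V 1 - V (- 1)\<bar> \<le> 99 / 100 * (52000 * t\<^sup>2) * M" .
  qed auto
  finally have diff: "\<bar>x - y\<bar> \<le> 52000 * t\<^sup>2" .
  have "157 / 100 * (1 / ?s) \<le> 157 / 100 * (8 * t ^ 3)" using s by (intro mult_left_mono) auto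
  also have "\<dots> = 157 / 100 * 8 * t * t\<^sup>2" by (simp add: eval_nat_numeral)
  also have "\<dots> \<le> 1 * t\<^sup>2" using t by (intro mult_right_mono) auto
  finally have "\<bar>x + y\<bar> \<le> t\<^sup>2" using sum by linarith
  then have xy: "\<bar>x\<bar> \<le> 30000 * t\<^sup>2" "\<bar>y\<bar> \<le> 30000 * t\<^sup>2" using diff zero_le_power2[of t] by linarith+
  have "t\<^sup>2 \<le> t * 1" unfolding power2_eq_square using t t_le_half[OF t] by (intro mult_left_mono) auto
  then have t2: "t\<^sup>2 \<le> 1 / 10 ^ 80" using t by linarith
  have small: "30000 * t\<^sup>2 \<le> 1 / 2" using t2 by simp
  have ln_bound: "\<bar>ln (1 + z) - z\<bar> \<le> 1800000000 * t ^ 4" if "\<bar>z\<bar> \<le> 30000 * t\<^sup>2" for z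
  proof -
    have "\<bar>ln (1 + z) - z\<bar> \<le> 2 * z\<^sup>2"
      using that small by (intro abs_ln_one_plus_x_minus_x_bound) linarith
    also have "z\<^sup>2 \<le> (30000 * t\<^sup>2)\<^sup>2" using power_mono[OF that, of 2] by simp
    finally show ?thesis by (simp add: power_mult_distrib flip: power_mult)
  qed
  have Vpos: "V 1 > 0" "V (- 1) > 0"
  proof -
    have "1 + x > 0" "1 + y > 0" using xy small by linarith+
    then show "V 1 > 0" "V (- 1) > 0" using V0_pos by (auto simp: x_def y_def zero_less_divide_iff)
  qed
  have Ln: "L n = ln (V 0 / (2 * pi)) + t * real n + cumulant 0 t"
    unfolding L_def V_def using n V0_pos by (intro ln_overp_eq t) (auto simp: V_def)
  have Lp: "L (n + 1) = ln (V 0 / (2 * pi)) + ln (1 + x) + t * (real n + 1) + cumulant 0 t"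
  proof -
    have "L (n + 1) = ln (V 1 / (2 * pi)) + t * real (n + 1) + cumulant 0 t"
      unfolding L_def V_def using n Vpos by (intro ln_overp_eq t) (auto simp: V_def)
    also have "V 1 / (2 * pi) = V 0 / (2 * pi) * (1 + x)" using V0_pos by (simp add: x_def)
    also have "ln \<dots> = ln (V 0 / (2 * pi)) + ln (1 + x)"
      using V0_pos Vpos by (intro ln_mult_pos) (auto simp: x_def)
    finally show ?thesis by simp
  qed
  have Lm: "L (n - 1) = ln (V 0 / (2 * pi)) + ln (1 + y) + t * (real n - 1) + cumulant 0 t"
  proof -
    have "L (n - 1) = ln (V (- 1) / (2 * pi)) + t * real (n - 1) + cumulant 0 t"
      unfolding L_def V_def using n Vpos by (intro ln_overp_eq t) (auto simp: V_def)
    also have "V (- 1) / (2 * pi) = V 0 / (2 * pi) * (1 + y)" using V0_pos by (simp add: y_def)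
    also have "ln \<dots> = ln (V 0 / (2 * pi)) + ln (1 + y)"
      using V0_pos Vpos by (intro ln_mult_pos) (auto simp: y_def)
    finally show ?thesis using n by (simp add: of_nat_diff)
  qed
  have main: "(real n)\<^sup>2 * (L (n + 1) + L (n - 1) - 2 * L n) - real n * (L (n + 1) - L (n - 1)) + 2 * L n
      = (real n)\<^sup>2 * (ln (1 + x) + ln (1 + y)) - real n * (ln (1 + x) - ln (1 + y)) + 2 * ln (V 0 / (2 * pi)) + 2 * cumulant 0 t"
    unfolding Lp Lm Ln by (simp add: algebra_simps)
  \<comment> \<open>By this bound, errors of order \<open>t\<^sup>2\<close> multiplied by
    \<open>n\<close> and of order \<open>t ^ 4\<close> multiplied by \<open>n\<^sup>2\<close> are
    bounded by absolute constants; \<open>10 ^ 12\<close> covers each of them.\<close>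
  have nt: "real n * t\<^sup>2 \<le> 16"
    using cumulant_le[OF t(1), of 1] n t by (simp add: field_simps power2_eq_square)
  have first: "(real n)\<^sup>2 * (ln (1 + x) + ln (1 + y)) \<ge> - 157 / 100 * cumulant 0 t - 10 ^ 12"
  proof -
    have "ln (1 + x) + ln (1 + y) \<ge> - (157 / 100 * (1 / ?s) + 3600000000 * t ^ 4)"
      using ln_bound[OF xy(1)] ln_bound[OF xy(2)] sum by linarith
    then have "(real n)\<^sup>2 * - (157 / 100 * (1 / ?s) + 3600000000 * t ^ 4) \<le> (real n)\<^sup>2 * (ln (1 + x) + ln (1 + y))"
      by (rule mult_left_mono) simp
    moreover have "(real n)\<^sup>2 * (1 / ?s) \<le> cumulant 0 t"
      using cumulant_1_square_le[OF t(1)] n s by (simp add: field_simps)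
    moreover have "(real n)\<^sup>2 * t ^ 4 \<le> 256"
    proof -
      have "(real n)\<^sup>2 * t ^ 4 = (real n * t\<^sup>2)\<^sup>2" by (simp add: power_mult_distrib flip: power_mult)
      also have "\<dots> \<le> 16\<^sup>2" using nt by (intro power_mono) auto
      finally show ?thesis by simp
    qed
    ultimately show ?thesis by (simp add: algebra_simps)
  qed
  have second: "real n * (ln (1 + x) - ln (1 + y)) \<le> 10 ^ 12"
  proof -
    have "t ^ 4 = t\<^sup>2 * t\<^sup>2" by (simp add: eval_nat_numeral)
    also have "\<dots> \<le> t\<^sup>2 * (1 / 3600000000)" by (intro mult_left_mono order_trans[OF t2]) auto
    finally have "3600000000 * t ^ 4 \<le> t\<^sup>2" by simp
    then have "ln (1 + x) - ln (1 + y) \<le> 53000 * t\<^sup>2"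
      using ln_bound[OF xy(1)] ln_bound[OF xy(2)] diff by linarith
    then have "real n * (ln (1 + x) - ln (1 + y)) \<le> real n * (53000 * t\<^sup>2)" by (rule mult_left_mono) simp
    also have "\<dots> \<le> 53000 * 16" using nt by simp
    finally show ?thesis by simp
  qed
  \<comment> \<open>The crude bound \<open>V 0 / (2 * pi) \<ge> t ^ 3\<close> is enough, because the
    logarithm of a power of \<open>t\<close> is negligible against \<open>1 / t\<close>.\<close>
  have third: "ln (V 0 / (2 * pi)) \<ge> - (1 / (100 * t))"
  proof -
    have "t ^ 3 = t\<^sup>2 * t" by (simp add: eval_nat_numeral)
    also have "\<dots> \<le> t\<^sup>2 * (1 / 10)" using t by (intro mult_left_mono) auto
    also have "\<dots> \<le> 99 / 100 * M / 8" using M zero_le_power2[of t] by linarith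
    also have "\<dots> \<le> V 0 / (2 * pi)"
      using V0 M pi_less_4 V0_pos by (intro frac_le) auto
    finally have "ln (t ^ 3) \<le> ln (V 0 / (2 * pi))" using t V0_pos by (intro ln_mono) auto
    moreover have "ln (t ^ 3) = 3 * ln t" using t by (simp add: ln_realpow)
    moreover have "ln t \<ge> - (1 / (300 * t))"
    proof -
      \<comment> \<open>In terms of \<open>r\<close>,
        \<open>ln (1 / t) = 2 * ln r \<le> 2 * r\<close>, and this is at most
        \<open>r\<^sup>2 / 300\<close> once \<open>r \<ge> 600\<close>.\<close>
      define r where "r = sqrt (1 / t)"
      have "1 / t \<ge> 10 ^ 80" using t by (simp add: field_simps)
      then have "r \<ge> sqrt (10 ^ 80)" unfolding r_def by (rule real_sqrt_le_mono)
      moreover have "sqrt (10 ^ 80) = (10 ^ 40 :: real)" by (rule real_sqrt_unique) auto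
      ultimately have r: "r \<ge> 600" by simp
      have rr: "1 / t = r\<^sup>2" unfolding r_def using t by simp
      have "ln (1 / t) = 2 * ln r" unfolding rr using r by (simp add: ln_realpow)
      also have "\<dots> \<le> 2 * r" using ln_le_minus_one[of r] r by simp
      also have "\<dots> \<le> r * r / 300" using r by simp
      also have "\<dots> = 1 / (300 * t)" using rr by (simp add: power2_eq_square)
      finally show ?thesis using t by (simp add: ln_div)
    qed
    ultimately show ?thesis by simp
  qed
  have large: "1 / t \<ge> 10 ^ 80" using t by (simp add: field_simps)
  have k0: "cumulant 0 t \<ge> 1 / t" by (rule cumulant_0_ge[OF t(1) t_le_half[OF t]])
  \<comment> \<open>Here \<open>u\<close> is \<open>1 / t\<close> and \<open>c\<close> is
    \<open>cumulant 0 t\<close>. The total is at least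
    \<open>0.43 * c - 2 * 10 ^ 12 - 0.02 * u\<close>, and
    \<open>c \<ge> u \<ge> 10 ^ 80\<close>.\<close>
  have "g \<le> p - q + 2 * l + 2 * c"
    if "10 ^ 80 \<le> u" "u \<le> c" "- 157 / 100 * c - 10 ^ 12 \<le> p" "q \<le> 10 ^ 12" "- d \<le> l"
      "d = 1 / 100 * u" "g = 1 / 10 * u" for g p q l c u d :: real
    using that by simp
  from this[OF large k0 first second third] show ?thesis unfolding main by simp
qed

section \<open>Log-convexity\<close>

lemma cumulant_1_surj:
  assumes "n \<ge> (1 :: nat)"
  obtains t where "t > 0" "cumulant 1 t = real n"
proof -
  define R :: "real fps" where "R = Abs_fps (\<lambda>k. real k * log_coeff k)"
  have term_eq: "fps_nth R k * exp (- t) ^ k = real k ^ 1 * weight t k" for k t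
    using exp_of_nat2_mult[of "- t" k] by (simp add: R_def weight_def)
  have "fps_conv_radius R \<ge> 1"
    unfolding fps_conv_radius_def
  proof (rule conv_radius_geI_ex')
    fix r :: real assume r: "0 < r" "ereal r < 1"
    then have "summable (\<lambda>k. real k ^ 1 * weight (- ln r) k)" by (intro summable_power_weight) auto
    then show "summable (\<lambda>k. fps_nth R k * of_real r ^ k)"
      using r term_eq[of _ "- ln r"] by simp
  qed
  then have "{0..<1} \<subseteq> eball (0 :: real) (fps_conv_radius R)"
    by (auto simp: eball_def intro!: less_le_trans[of _ 1 "fps_conv_radius R"])
  then have cont: "continuous_on {0..<1} (eval_fps R)"
    by (rule continuous_on_subset[OF continuous_on_eval_fps])
  have eval: "eval_fps R (exp (- t)) = cumulant 1 t" for t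
    unfolding eval_fps_def cumulant_def term_eq ..
  \<comment> \<open>With this choice \<open>1 / t1\<^sup>2 = 4 * n\<^sup>2\<close>, which exceeds
    \<open>n\<close>, and \<open>t1 \<le> 1 / 2\<close> as required by
    \<open>cumulant_1_ge\<close>.\<close>
  define t1 where "t1 = 1 / (2 * real n)"
  have t1: "0 < t1" "t1 \<le> 1 / 2" using assms by (auto simp: t1_def field_simps)
  have "real n \<le> (2 * real n)\<^sup>2" using assms by (simp add: power2_eq_square)
  also have "\<dots> = 1 / t1\<^sup>2" by (simp add: t1_def power_divide)
  also have "\<dots> \<le> eval_fps R (exp (- t1))" unfolding eval by (rule cumulant_1_ge[OF t1])
  finally have ge: "real n \<le> eval_fps R (exp (- t1))" .
  have 0: "eval_fps R 0 = 0" by (simp add: eval_fps_at_0 R_def)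
  \<comment> \<open>In the variable \<open>x = exp (- t)\<close> the left endpoint is
    \<open>x = 0\<close>, where the power series vanishes, so the intermediate value theorem applies
    on a compact interval.\<close>
  have "\<exists>x. 0 \<le> x \<and> x \<le> exp (- t1) \<and> eval_fps R x = real n"
  proof (intro IVT' continuous_on_subset[OF cont])
    have "exp (- t1) < 1" using t1 by simp
    then have "x < 1" if "x \<le> exp (- t1)" for x using that by linarith
    then show "{0..exp (- t1)} \<subseteq> {0..<1}" by auto
  qed (use ge in \<open>auto simp: 0\<close>)
  then obtain x where x: "0 \<le> x" "x \<le> exp (- t1)" "eval_fps R x = real n" by blast
  have "x \<noteq> 0" using x(3) 0 assms by auto
  with x have "x > 0" by simp
  show thesis
  proof (rule that[of "- ln x"])
    have "ln x \<le> - t1" using x \<open>x > 0\<close> ln_mono[of x "exp (- t1)"] by simp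
    then show "- ln x > 0" using t1 by linarith
    show "cumulant 1 (- ln x) = real n" using eval[of "- ln x"] x \<open>x > 0\<close> by simp
  qed
qed

text \<open>The bound \<open>cumulant 1 t \<le> 16 / t\<^sup>2\<close> is used twice at the saddle
  point: it forces \<open>t \<le> 1 / 10 ^ 80\<close>, and it expresses \<open>1 / t\<close> through
  \<open>sqrt n\<close>.\<close>

lemma ln_overp_convexity:
  fixes n :: nat
  assumes n: "real n \<ge> 16 * 10 ^ 160"
  defines "L \<equiv> \<lambda>m. ln (real (overp m))"
  shows "(real n)\<^sup>2 * (L (n + 1) + L (n - 1) - 2 * L n) - real n * (L (n + 1) - L (n - 1)) + 2 * L n
           \<ge> sqrt (real n) / 40"
proof -
  have n1: "n \<ge> 1" using n by (cases n) auto
  then obtain t where t: "t > 0" "cumulant 1 t = real n" by (rule cumulant_1_surj)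
  have "real n \<le> 16 / t\<^sup>2" using cumulant_le[OF t(1), of 1] t by (simp add: power2_eq_square)
  then have "real n \<le> (4 / t)\<^sup>2" by (simp add: power_divide)
  then have sq: "sqrt (real n) \<le> 4 / t" using t by (intro real_le_lsqrt) auto
  have "sqrt (16 * 10 ^ 160) = (4 * 10 ^ 80 :: real)" by (rule real_sqrt_unique) auto
  then have "4 * 10 ^ 80 \<le> sqrt (real n)" using real_sqrt_le_mono[OF n] by simp
  with sq have "4 * 10 ^ 80 \<le> 4 / t" by linarith
  then have "t \<le> 1 / 10 ^ 80" using t by (simp add: field_simps)
  from ln_overp_convexity_at_saddle[OF t(1) this t(2)[symmetric] n1]
  have "1 / (10 * t) \<le> (real n)\<^sup>2 * (L (n + 1) + L (n - 1) - 2 * L n) - real n * (L (n + 1) - L (n - 1)) + 2 * L n"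
    unfolding L_def .
  moreover have "sqrt (real n) / 40 \<le> 1 / (10 * t)" using sq by simp
  ultimately show ?thesis by linarith
qed

section \<open>From overpartition numbers to the normalised roots\<close>

lemma overp_pos: "overp n > 0"
proof (cases "n = 0")
  case False
  then have "[(n, False)] \<in> overpartitions n" by (auto simp: overpartitions_def)
  then show ?thesis unfolding overp_def using finite_overpartitions card_gt_0_iff by blast
qed (simp add: overp_0)

text \<open>With \<open>N = z ^ 227\<close> one has \<open>ln N = 227 * ln z\<close> and
  \<open>\<alpha> \<le> z / 12\<close>, so the left side is at most quadratic in \<open>z\<close>,
  whereas \<open>sqrt N \<ge> z ^ 113\<close>.\<close>

lemma two_alpha_ln_less_sqrt:
  fixes \<alpha> N :: real
  assumes "\<alpha> \<ge> 0" "(12 + 12 * \<alpha>) ^ 227 \<le> N"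
  shows "2 * \<alpha> * ln N < sqrt N / 40"
proof -
  have "0 < (12 + 12 * \<alpha>) ^ 227" using assms by (intro zero_less_power) auto
  then have N: "N > 0" using assms by linarith
  define z where "z = root 227 N"
  have Nz: "N = z ^ 227" using N by (simp add: z_def)
  have "12 + 12 * \<alpha> = root 227 ((12 + 12 * \<alpha>) ^ 227)"
    using assms by (intro real_root_power_cancel[symmetric]) auto
  also have "\<dots> \<le> z" unfolding z_def using assms by (intro real_root_le_mono) auto
  finally have z: "12 + 12 * \<alpha> \<le> z" .
  then have z12: "z \<ge> 12" using assms by linarith
  have "2 * \<alpha> * ln N = 2 * \<alpha> * (227 * ln z)" unfolding Nz using z12 by (simp add: ln_realpow)
  also have "\<dots> \<le> (z / 6) * (227 * z)"
  proof (intro mult_mono)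
    show "ln z \<le> z" using ln_le_minus_one[of z] z12 by simp
  qed (use z z12 assms in auto)
  also have "\<dots> = 227 / 6 * z\<^sup>2" by (simp add: power2_eq_square)
  also have "\<dots> < 12 ^ 111 / 40 * z\<^sup>2" using z12 by (intro mult_strict_right_mono) auto
  also have "\<dots> \<le> z ^ 111 / 40 * z\<^sup>2"
    using z12 by (intro mult_right_mono divide_right_mono power_mono) auto
  also have "\<dots> = z ^ 113 / 40" by (simp flip: power_add)
  also have "\<dots> \<le> sqrt N / 40"
  proof (intro divide_right_mono real_le_rsqrt)
    have "(z ^ 113)\<^sup>2 = z ^ 226" by (simp flip: power_mult)
    also have "\<dots> \<le> z ^ 227" using z12 by (intro power_increasing) auto
    finally show "(z ^ 113)\<^sup>2 \<le> N" unfolding Nz .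
  qed simp
  finally show ?thesis .
qed

lemma r_seq_pos: "n > 0 \<Longrightarrow> r_seq \<alpha> n > 0"
  unfolding r_seq_def using overp_pos[of n] by (intro real_root_gt_zero divide_pos_pos) auto

lemma ln_r_seq: "n > 0 \<Longrightarrow> ln (r_seq \<alpha> n) = (ln (real (overp n)) - \<alpha> * ln (real n)) / real n"
  unfolding r_seq_def using overp_pos[of n] by (simp add: ln_root ln_div ln_powr)

text \<open>After taking logarithms, the second difference of
  \<open>(L m - \<alpha> * ln m) / m\<close> at \<open>n\<close> must be positive. Multiplied by
  \<open>N * (N - 1) * (N + 1)\<close> it is the combination from \<open>ln_overp_convexity\<close>
  minus \<alpha> times the same combination for \<open>ln\<close>.\<close>

lemma r_seq_log_convex:
  fixes n :: nat
  assumes "\<alpha> \<ge> 0" "(12 + 12 * \<alpha>) ^ 227 \<le> real n"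
  shows "(r_seq \<alpha> n)\<^sup>2 < r_seq \<alpha> (n - 1) * r_seq \<alpha> (n + 1)"
proof -
  have "(12 :: real) ^ 227 \<le> (12 + 12 * \<alpha>) ^ 227" using assms by (intro power_mono) auto
  then have big: "real n \<ge> 12 ^ 227" using assms by linarith
  then have n2: "n \<ge> 2" by (intro ccontr[of "n \<ge> 2"]) (auto simp: not_le)
  define N where "N = real n"
  have N: "N \<ge> 2" "real (n - 1) = N - 1" "real (n + 1) = N + 1" using n2 by (auto simp: N_def)
  define L where "L = (\<lambda>m. ln (real (overp m)))"
  have 1: "N\<^sup>2 * (L (n + 1) + L (n - 1) - 2 * L n) - N * (L (n + 1) - L (n - 1)) + 2 * L n \<ge> sqrt N / 40"
    unfolding N_def L_def using big by (intro ln_overp_convexity) (auto intro: order_trans[rotated])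
  \<comment> \<open>Concavity makes the second difference of \<open>ln\<close> nonpositive, and
    monotonicity makes the first difference nonnegative.\<close>
  have 2: "N\<^sup>2 * (ln (N + 1) + ln (N - 1) - 2 * ln N) - N * (ln (N + 1) - ln (N - 1)) + 2 * ln N \<le> 2 * ln N"
  proof -
    have "ln (N + 1) + ln (N - 1) = ln ((N + 1) * (N - 1))" using N by (intro ln_mult_pos[symmetric]) auto
    also have "\<dots> \<le> ln (N * N)"
      using N mult_pos_pos[of "N + 1" "N - 1"] by (intro ln_mono) (auto simp: algebra_simps)
    also have "\<dots> = 2 * ln N" using N by (simp add: ln_mult_pos)
    finally have "N\<^sup>2 * (ln (N + 1) + ln (N - 1) - 2 * ln N) \<le> 0" by (intro mult_nonneg_nonpos) auto
    moreover have "N * (ln (N + 1) - ln (N - 1)) \<ge> 0" using N by (intro mult_nonneg_nonneg) auto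
    ultimately show ?thesis by linarith
  qed
  have 3: "\<alpha> * (N\<^sup>2 * (ln (N + 1) + ln (N - 1) - 2 * ln N) - N * (ln (N + 1) - ln (N - 1)) + 2 * ln N) < sqrt N / 40"
  proof (rule le_less_trans[OF mult_left_mono[OF 2 assms(1)]])
    show "\<alpha> * (2 * ln N) < sqrt N / 40"
      using two_alpha_ln_less_sqrt[OF assms] by (simp add: N_def mult_ac)
  qed
  define A B C where "A = L (n - 1) - \<alpha> * ln (N - 1)" and "B = L n - \<alpha> * ln N" and "C = L (n + 1) - \<alpha> * ln (N + 1)"
  have "N\<^sup>2 * (C + A - 2 * B) - N * (C - A) + 2 * B > 0"
    using 1 3 unfolding A_def B_def C_def by (simp add: algebra_simps)
  then have "0 < (N\<^sup>2 * (C + A - 2 * B) - N * (C - A) + 2 * B) / (N * (N - 1) * (N + 1))"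
    using N by (intro divide_pos_pos mult_pos_pos) auto
  also have "\<dots> = A / (N - 1) + C / (N + 1) - 2 * (B / N)"
  proof -
    define D where "D = N * (N - 1) * (N + 1)"
    have "A / (N - 1) = A * (N * (N + 1)) / D" "C / (N + 1) = C * (N * (N - 1)) / D"
      "2 * (B / N) = 2 * B * ((N - 1) * (N + 1)) / D"
      using N unfolding D_def by simp_all
    then have "A / (N - 1) + C / (N + 1) - 2 * (B / N)
        = (A * (N * (N + 1)) + C * (N * (N - 1)) - 2 * B * ((N - 1) * (N + 1))) / D"
      by (simp only: add_divide_distrib diff_divide_distrib)
    also have "A * (N * (N + 1)) + C * (N * (N - 1)) - 2 * B * ((N - 1) * (N + 1))
        = N\<^sup>2 * (C + A - 2 * B) - N * (C - A) + 2 * B"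
      by (simp add: algebra_simps power2_eq_square)
    finally show ?thesis unfolding D_def ..
  qed
  finally have *: "2 * (B / N) < A / (N - 1) + C / (N + 1)" by simp
  have pos: "r_seq \<alpha> n > 0" "r_seq \<alpha> (n - 1) > 0" "r_seq \<alpha> (n + 1) > 0" using n2 by (auto intro!: r_seq_pos)
  have "ln ((r_seq \<alpha> n)\<^sup>2) = 2 * (B / N)"
    using n2 pos by (simp add: ln_realpow ln_r_seq B_def L_def N_def)
  moreover have "ln (r_seq \<alpha> (n - 1) * r_seq \<alpha> (n + 1)) = A / (N - 1) + C / (N + 1)"
    using n2 pos ln_r_seq[of "n - 1" \<alpha>] ln_r_seq[of "n + 1" \<alpha>]
    by (simp only: ln_mult_pos N A_def C_def L_def)
  ultimately have "ln ((r_seq \<alpha> n)\<^sup>2) < ln (r_seq \<alpha> (n - 1) * r_seq \<alpha> (n + 1))" using * by simp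
  then show ?thesis using pos by (subst (asm) ln_less_cancel_iff) auto
qed

text \<open>By \<open>eq\<close>, \<open>b * c * (a * d - b * c)\<close> is
  \<open>x * c\<^sup>2 + y * b\<^sup>2 + x * y\<close>. The inequality of arithmetic and geometric
  means for the first two summands gives the bound, and the positive term \<open>x * y\<close> makes
  it strict.\<close>

lemma log_convex_imp_turan_negative:
  fixes a b c d :: real
  assumes pos: "b > 0" "c > 0" and convex: "b\<^sup>2 < a * c" "c\<^sup>2 < b * d"
  shows "4 * (b\<^sup>2 - a * c) * (c\<^sup>2 - b * d) - (b * c - a * d)\<^sup>2 < 0"
proof -
  define x y where "x = a * c - b\<^sup>2" and "y = b * d - c\<^sup>2"
  have xy: "x > 0" "y > 0" using convex by (auto simp: x_def y_def)
  have eq: "b * c * (a * d - b * c) = x * c\<^sup>2 + y * b\<^sup>2 + x * y"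
    by (simp add: x_def y_def algebra_simps power2_eq_square)
  have "(b * c)\<^sup>2 * (4 * x * y) \<le> (x * c\<^sup>2 + y * b\<^sup>2)\<^sup>2"
    using zero_le_power2[of "x * c\<^sup>2 - y * b\<^sup>2"] by (simp add: algebra_simps power2_eq_square)
  also have "\<dots> < (x * c\<^sup>2 + y * b\<^sup>2 + x * y)\<^sup>2"
    using xy pos by (intro power_strict_mono) (auto intro!: add_nonneg_nonneg mult_nonneg_nonneg)
  also have "\<dots> = (b * c)\<^sup>2 * (a * d - b * c)\<^sup>2" by (simp only: flip: eq power_mult_distrib)
  finally have "4 * x * y < (a * d - b * c)\<^sup>2" using pos by simp
  moreover have "(a * d - b * c)\<^sup>2 = (b * c - a * d)\<^sup>2" by (rule power2_commute)
  moreover have "4 * (b\<^sup>2 - a * c) * (c\<^sup>2 - b * d) = 4 * x * y" by (simp add: x_def y_def algebra_simps)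
  ultimately show ?thesis by simp
qed

lemma N_T_ge: "(12 + 12 * \<alpha>) ^ 227 \<le> real_of_int (N_T \<alpha>)"
proof -
  have "\<lceil>(12 + 12 * \<alpha>) ^ 227\<rceil> \<le> N_2 \<alpha>" unfolding N_2_def by (rule Max_ge) auto
  also have "\<dots> \<le> N_T \<alpha>" unfolding N_T_def by (rule Max_ge) auto
  finally show ?thesis by (simp add: ceiling_le_iff)
qed

theorem theorem1p2:
  fixes \<alpha> :: real and n :: nat
  assumes "\<alpha> \<ge> 0" and "int n \<ge> N_T \<alpha>"
  shows "4 * ((r_seq \<alpha> n)\<^sup>2 - r_seq \<alpha> (n - 1) * r_seq \<alpha> (n + 1))
           * ((r_seq \<alpha> (n + 1))\<^sup>2 - r_seq \<alpha> n * r_seq \<alpha> (n + 2))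
         - (r_seq \<alpha> n * r_seq \<alpha> (n + 1) - r_seq \<alpha> (n - 1) * r_seq \<alpha> (n + 2))\<^sup>2 < 0"
proof -
  have "real_of_int (N_T \<alpha>) \<le> real n" using assms(2) by linarith
  then have n: "(12 + 12 * \<alpha>) ^ 227 \<le> real n" using N_T_ge[of \<alpha>] by linarith
  then have Suc_n: "(12 + 12 * \<alpha>) ^ 227 \<le> real (n + 1)" by simp
  have "0 < (12 + 12 * \<alpha>) ^ 227" using assms by (intro zero_less_power) auto
  then have "n > 0" using n by (intro Nat.gr0I) auto
  then show ?thesis
    using r_seq_log_convex[OF assms(1) n] r_seq_log_convex[OF assms(1) Suc_n]
    by (intro log_convex_imp_turan_negative r_seq_pos) auto
qed

end
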